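(* Let $m_X,m_Y,\Omega_X,\Omega_Y,\bar\gamma>0$, let $p,q$ be coprime positive integers and $\alpha=2p/q$, and let $\gamma$ be the instantaneous SNR of the $\alpha$-Beaulieu–Xie shadowed channel with average SNR $\bar\gamma$. Then the ergodic capacity $\overline{C}:=\mathbb{E}[\log_2(1+\gamma)]$ equals $$\overline{C}=\frac{q^{m_X-\frac12}(1-\bar\beta)^{m_Y}}{(2\pi)^{\frac{q-3}{2}+p}\ln 2}\sum_{k=0}^\infty\frac{(m_Y)_k}{\Gamma(m_X+k)}\frac{(q\bar\beta)^k}{k!}\,G^{\,q+p+1,\,p}_{p+1,\,q+p+1}\!\left(\Big(\frac{1}{q\,\mathrm{C}_\alpha\bar\gamma^{\alpha/2}}\Big)^q\,\middle|\,\begin{matrix}\Delta(p,0),\,1\\ \Delta(p,0),\,\Delta(q,m_X+k),\,0\end{matrix}\right).$$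
   Context: Fix parameters $m_X,m_Y,\Omega_X,\Omega_Y>0$. The Beaulieu–Xie shadowed envelope is a random variable $\bar R>0$ with density $$f_{\bar R}(r)=\frac{2r^{2m_X-1}}{\Gamma(m_X)}\left(\frac{m_Y\Omega_X}{m_Y\Omega_X+m_X\Omega_Y}\right)^{m_Y}\left(\frac{m_X}{\Omega_X}\right)^{m_X}{}_1F_1\!\left(m_Y;m_X;\frac{m_X^2\Omega_Y r^2}{\Omega_X(m_Y\Omega_X+m_X\Omega_Y)}\right)e^{-\frac{m_X}{\Omega_X}r^2},\quad r>0.$$ Set $\bar\beta=\frac{m_X\Omega_Y}{m_Y\Omega_X+m_X\Omega_Y}$. For $\alpha>0$ put $$\mathrm{C}_\alpha=\left[\frac{\Gamma(m_X)}{\Gamma(m_X+\frac{2}{\alpha})\,{}_2F_1\!\left(m_Y,-\frac{2}{\alpha};m_X;-\frac{m_X\Omega_Y}{m_Y\Omega_X}\right)}\right]^{\alpha/2}.$$ For $\bar\gamma>0$, the instantaneous SNR of the $\alpha$-Beaulieu–Xie shadowed channel with average SNR $\bar\gamma$ is the random variable $\gamma=\bar\gamma\,\big(\mathrm{C}_\alpha m_X\bar R^2/\Omega_X\big)^{2/\alpha}$. Here ${}_1F_1(a;b;z)=\sum_{n\ge0}\frac{(a)_n}{(b)_n}\frac{z^n}{n!}$, ${}_2F_1$ is the Gauss hypergeometric function, $(a)_n$ the Pochhammer symbol. $\Delta(a,b)$ denotes the list $\frac{b}{a},\frac{b+1}{a},\dots,\frac{b+a-1}{a}$. $G^{m,n}_{P,Q}$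 is the Meijer G-function, $G^{m,n}_{P,Q}\!\left(z\middle|\begin{matrix}a_1,\dots,a_P\\ b_1,\dots,b_Q\end{matrix}\right)=\frac{1}{2\pi i}\int_L\frac{\prod_{j=1}^m\Gamma(b_j-s)\prod_{j=1}^n\Gamma(1-a_j+s)}{\prod_{j=m+1}^Q\Gamma(1-b_j+s)\prod_{j=n+1}^P\Gamma(a_j-s)}z^s\,ds$ with the standard contour $L$. *)

theory Defs
  imports "HOL-Probability.Probability"
begin

definition hyp1F1 :: "real \<Rightarrow> real \<Rightarrow> real \<Rightarrow> real" where
  "hyp1F1 a b z = (\<Sum>n. pochhammer a n / pochhammer b n * z ^ n / fact n)"

definition hyp2F1_series :: "real \<Rightarrow> real \<Rightarrow> real \<Rightarrow> real \<Rightarrow> real" where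
  "hyp2F1_series a b c z =
     (\<Sum>n. pochhammer a n * pochhammer b n / pochhammer c n * z ^ n / fact n)"

text \<open>Gauss hypergeometric function 2F1 on the real half-line z < 1: the power series
  for abs z < 1, and its analytic continuation (via the Pfaff transformation) for z \<le> -1.\<close>
definition hyp2F1 :: "real \<Rightarrow> real \<Rightarrow> real \<Rightarrow> real \<Rightarrow> real" where
  "hyp2F1 a b c z =
     (if \<bar>z\<bar> < 1 then hyp2F1_series a b c z
      else (1 - z) powr (- a) * hyp2F1_series a (c - b) c (z / (z - 1)))"

definition Delta :: "nat \<Rightarrow> real \<Rightarrow> real list" where
  "Delta a b = map (\<lambda>i. (b + real i) / real a) [0..<a]"

definition meijerG_integrand ::
  "nat \<Rightarrow> nat \<Rightarrow> real list \<Rightarrow> real list \<Rightarrow> real \<Rightarrow> complex \<Rightarrow> complex" where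
  "meijerG_integrand m n as bs z s =
     (\<Prod>j<m. Gamma (of_real (bs ! j) - s)) * (\<Prod>j<n. Gamma (1 - of_real (as ! j) + s))
     / ((\<Prod>j\<in>{m..<length bs}. Gamma (1 - of_real (bs ! j) + s))
        * (\<Prod>j\<in>{n..<length as}. Gamma (of_real (as ! j) - s)))
     * exp (s * of_real (ln z))"

text \<open>Abscissa of a vertical line separating the poles of Gamma(b_j - s), j < m,
  (at s = b_j + k) from those of Gamma(1 - a_j + s), j < n (at s = a_j - 1 - k).\<close>
definition meijerG_abscissa :: "nat \<Rightarrow> nat \<Rightarrow> real list \<Rightarrow> real list \<Rightarrow> real" where
  "meijerG_abscissa m n as bs =
     (let B = Min ((\<lambda>j. bs ! j) ` {..<m});
          A = (if n = 0 then B - 1 else Max ((\<lambda>j. as ! j - 1) ` {..<n}))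
      in (A + B) / 2)"

text \<open>Meijer G-function with the contour L taken to be the vertical line
  Re s = c separating the two families of poles (the standard contour whenever such a line
  exists and m + n > (P+Q)/2, z > 0):
  G = 1/(2 pi i) \<integral>_{c - i\<infinity>}^{c + i\<infinity>} ... ds = 1/(2 pi) \<integral>_R integrand(c + i t) dt.\<close>
definition meijerG :: "nat \<Rightarrow> nat \<Rightarrow> real list \<Rightarrow> real list \<Rightarrow> real \<Rightarrow> complex" where
  "meijerG m n as bs z =
     (let c = meijerG_abscissa m n as bs in
      (LINT t|lborel. meijerG_integrand m n as bs z (Complex c t)) / (2 * of_real pi))"

definition bx_pdf :: "real \<Rightarrow> real \<Rightarrow> real \<Rightarrow> real \<Rightarrow> real \<Rightarrow> real" where
  "bx_pdf mX mY OX OY r =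
     (if r \<le> 0 then 0 else
      2 * r powr (2 * mX - 1) / Gamma mX
      * (mY * OX / (mY * OX + mX * OY)) powr mY
      * (mX / OX) powr mX
      * hyp1F1 mY mX (mX\<^sup>2 * OY * r\<^sup>2 / (OX * (mY * OX + mX * OY)))
      * exp (- (mX / OX) * r\<^sup>2))"

definition bx_beta :: "real \<Rightarrow> real \<Rightarrow> real \<Rightarrow> real \<Rightarrow> real" where
  "bx_beta mX mY OX OY = mX * OY / (mY * OX + mX * OY)"

definition bx_C :: "real \<Rightarrow> real \<Rightarrow> real \<Rightarrow> real \<Rightarrow> real \<Rightarrow> real" where
  "bx_C \<alpha> mX mY OX OY =
     (Gamma mX / (Gamma (mX + 2 / \<alpha>) * hyp2F1 mY (- 2 / \<alpha>) mX (- mX * OY / (mY * OX))))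
       powr (\<alpha> / 2)"

definition alpha_bx_snr :: "real \<Rightarrow> real \<Rightarrow> real \<Rightarrow> real \<Rightarrow> real \<Rightarrow> real \<Rightarrow> real \<Rightarrow> real" where
  "alpha_bx_snr \<alpha> mX mY OX OY gbar r =
     gbar * (bx_C \<alpha> mX mY OX OY * mX * r\<^sup>2 / OX) powr (2 / \<alpha>)"

end

theory Submission
  imports Defs "HOL-Real_Asymp.Real_Asymp"
begin

text \<open>
  In the variable \<open>x = ln (mX R\<^sup>2 / OX)\<close> the density is
  \<open>(1 - \<beta>)^mY / \<Gamma>(mX) exp (mX x - e^x) 1F1 (mY; mX; \<beta> e^x)\<close> and the SNR is \<open>exp (y + (q/p) x)\<close> for a
  constant \<open>y\<close>. Expanding \<open>1F1\<close> termwise reduces the capacity to the integrals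
  \<open>\<integral> exp (\<mu> x - e^x) ln (1 + exp (y + (q/p) x)) dx\<close> with \<open>\<mu> = mX + k\<close>. The Fourier transform of the
  hyperbolic secant is again a hyperbolic secant (Euler's reflection formula), which after integration
  represents \<open>ln (1 + e^y)\<close> as the Mellin--Barnes integral of \<open>\<pi> e^(u y) / (u sin (\<pi> u))\<close>
  along \<open>Re u = 1/2\<close>. Exchanging integrals produces
  \<open>\<Gamma>(\<mu> + (q/p) u) \<Gamma>(u) \<Gamma>(1 - u) / u\<close>, and the substitution \<open>s = - u / p\<close> together with the Gauss
  multiplication formula for \<open>\<Gamma>\<close> turns this into the integrand of the Meijer G-function.
  The constant \<open>C\<^sub>\<alpha>\<close> only matters through its positivity.
\<close>

section \<open>The Mellin--Barnes representation of \<open>ln (1 + exp y)\<close>\<close>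

text \<open>Substitution \<open>t = exp x\<close> with Jacobian \<open>exp x\<close>. It moves
  Mellin-type integrals from the half-line to the whole line, where multiplicative scaling becomes
  translation.\<close>

lemma has_bochner_integral_exp_substitution:
  fixes f :: "real \<Rightarrow> 'a :: euclidean_space"
  assumes [measurable]: "f \<in> borel_measurable borel"
  shows "has_bochner_integral lborel (\<lambda>x. exp x *\<^sub>R f (exp x)) I \<longleftrightarrow>
         has_bochner_integral lborel (\<lambda>t. indicator {0<..} t *\<^sub>R f t) I"
proof -
  have range_exp: "exp ` (UNIV :: real set) = {0<..}"
    by (auto simp: image_iff intro: exp_ln[symmetric])
  have key: "(\<lambda>x. \<bar>exp x\<bar> *\<^sub>R f (exp x)) absolutely_integrable_on UNIV \<and>
          integral UNIV (\<lambda>x. \<bar>exp x\<bar> *\<^sub>R f (exp x)) = I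
          \<longleftrightarrow> f absolutely_integrable_on exp ` (UNIV :: real set) \<and> integral (exp ` UNIV) f = I"
    by (rule has_absolute_integral_change_of_variables_real)
       (auto intro!: derivative_eq_intros injI)
  \<comment> \<open>The change-of-variables theorem speaks of absolute integrability over the
    completed measure; for Borel functions this agrees with Bochner integrability over
    \<open>lborel\<close>.\<close>
  have iff: "has_bochner_integral lborel (\<lambda>t. indicator S t *\<^sub>R h t) I \<longleftrightarrow>
        h absolutely_integrable_on S \<and> integral S h = I"
    if [measurable]: "h \<in> borel_measurable borel" "S \<in> sets borel" for h :: "real \<Rightarrow> 'a" and S
  proof -
    have "h absolutely_integrable_on S \<longleftrightarrow> integrable lborel (\<lambda>t. indicator S t *\<^sub>R h t)"
      unfolding set_integrable_def by (subst integrable_completion) auto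
    moreover have "integral\<^sup>L lborel (\<lambda>t. indicator S t *\<^sub>R h t) = integral S h"
      if "integrable lborel (\<lambda>t. indicator S t *\<^sub>R h t)"
      using set_borel_integral_eq_integral(2)[of S h] that
      by (simp add: set_integrable_def set_lebesgue_integral_def)
    ultimately show ?thesis
      by (auto simp: has_bochner_integral_iff)
  qed
  show ?thesis
    using key iff[of f "{0<..}"] iff[of "\<lambda>x. exp x *\<^sub>R f (exp x)" UNIV] by (simp add: range_exp)
qed

text \<open>Euler's integral under \<open>t = exp x\<close>: the Jacobian raises
  \<open>t powr (s - 1)\<close> to \<open>exp (s * x)\<close>.\<close>

lemma has_bochner_integral_Gamma:
  fixes s :: complex
  assumes "Re s > 0"
  shows "has_bochner_integral lborel (\<lambda>x. exp (s * of_real x - of_real (exp x))) (Gamma s)"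
proof -
  let ?f = "\<lambda>t::real. exp ((s - 1) * of_real (ln t) - of_real t) :: complex"
  have eq: "exp x *\<^sub>R ?f (exp x) = exp (s * of_real x - of_real (exp x))" for x
  proof -
    have "exp x *\<^sub>R ?f (exp x) = exp (of_real x + ((s - 1) * of_real x - of_real (exp x)))"
      unfolding exp_add by (simp add: scaleR_conv_of_real exp_of_real)
    also have "of_real x + ((s - 1) * of_real x - of_real (exp x)) = s * of_real x - of_real (exp x)"
      by (simp add: algebra_simps)
    finally show ?thesis .
  qed
  have eq': "indicator {0<..} t *\<^sub>R ?f t =
      indicator {0<..} t *\<^sub>R (of_real t powr (s - 1) / of_real (exp t))" for t
    by (auto simp: indicator_def powr_def exp_diff exp_of_real Ln_of_real)
  have m [measurable]: "?f \<in> borel_measurable borel" by measurable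
  have "integrable lebesgue (\<lambda>t. indicator {0<..} t *\<^sub>R ?f t)"
    using absolutely_integrable_Gamma_integral'[OF assms]
    unfolding set_integrable_def eq' .
  hence abs: "integrable lborel (\<lambda>t. indicator {0<..} t *\<^sub>R ?f t)"
    by (subst (asm) integrable_completion) auto
  moreover have "integral\<^sup>L lborel (\<lambda>t. indicator {0<..} t *\<^sub>R ?f t) = Gamma s"
  proof -
    have "(?f has_integral Gamma s) {0<..}"
      by (rule has_integral_eq[OF _ Gamma_integral_complex'[OF assms]])
         (auto simp: powr_def exp_diff exp_of_real Ln_of_real)
    thus ?thesis
      using set_borel_integral_eq_integral(2)[of "{0<..}" ?f] abs
      by (simp add: set_integrable_def set_lebesgue_integral_def integral_unique)
  qed
  ultimately show ?thesis
    using has_bochner_integral_exp_substitution[OF m, of "Gamma s"]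
    by (simp only: eq has_bochner_integral_iff) 
qed

text \<open>Translating \<open>x\<close> by \<open>ln c\<close> turns \<open>exp x\<close> into
  \<open>c * exp x\<close> at the cost of a factor \<open>exp (s * ln c)\<close>.\<close>

lemma has_bochner_integral_Gamma_scaled:
  fixes s :: complex
  assumes "Re s > 0" "c > 0"
  shows "has_bochner_integral lborel (\<lambda>x. exp (s * of_real x - of_real (c * exp x)))
           (Gamma s * exp (- s * of_real (ln c)))"
proof -
  have "has_bochner_integral lborel
          (\<lambda>x. exp (s * of_real (ln c + 1 * x) - of_real (exp (ln c + 1 * x)))) (Gamma s /\<^sub>R \<bar>1\<bar>)"
    using lborel_has_bochner_integral_real_affine_iff
      [of 1 "\<lambda>x. exp (s * of_real x - of_real (exp x))" "Gamma s" "ln c"]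
      has_bochner_integral_Gamma[OF assms(1)] by simp
  from has_bochner_integral_mult_left[OF this, of "exp (- s * of_real (ln c))"]
  have "has_bochner_integral lborel
          (\<lambda>x. exp (s * of_real (ln c + 1 * x) - of_real (exp (ln c + 1 * x))) * exp (- s * of_real (ln c)))
          (Gamma s * exp (- s * of_real (ln c)))"
    by simp
  moreover have "exp (s * of_real (ln c + 1 * x) - of_real (exp (ln c + 1 * x))) * exp (- s * of_real (ln c))
      = exp (s * of_real x - of_real (c * exp x))" for x
  proof -
    have e: "exp (ln c + 1 * x) = c * exp x" using assms(2) by (simp add: exp_add)
    show ?thesis unfolding e mult_exp_exp by (simp add: algebra_simps)
  qed
  ultimately show ?thesis by simp
qed

lemma has_bochner_integral_Gamma_real:
  fixes s :: real
  assumes "s > 0"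
  shows "has_bochner_integral lborel (\<lambda>x. exp (s * x - exp x)) (Gamma s)"
proof -
  have "exp (of_real s * of_real x - of_real (exp x)) = complex_of_real (exp (s * x - exp x))" for x
    by (simp flip: exp_of_real)
  with has_bochner_integral_Re[OF has_bochner_integral_Gamma[of "of_real s"]] assms
  show ?thesis by (simp add: Gamma_complex_of_real)
qed

lemma lborel_Fubini:
  fixes f :: "real \<Rightarrow> real \<Rightarrow> 'a :: {banach, second_countable_topology}"
  assumes "case_prod f \<in> borel_measurable (borel \<Otimes>\<^sub>M borel)"
    and "\<And>x. integrable lborel (f x)"
    and "integrable lborel (\<lambda>x. \<integral>y. norm (f x y) \<partial>lborel)"
  shows "integrable lborel (\<lambda>y. \<integral>x. f x y \<partial>lborel)"
    and "(\<integral>y. \<integral>x. f x y \<partial>lborel \<partial>lborel) = (\<integral>x. \<integral>y. f x y \<partial>lborel \<partial>lborel)"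
proof -
  have *: "integrable (lborel \<Otimes>\<^sub>M lborel) (case_prod f)"
    using assms by (intro lborel_pair.Fubini_integrable) (auto simp: measurable_pair_measure_countable1)
  show "integrable lborel (\<lambda>y. \<integral>x. f x y \<partial>lborel)"
    using lborel_pair.integrable_snd[OF *] .
  show "(\<integral>y. \<integral>x. f x y \<partial>lborel \<partial>lborel) = (\<integral>x. \<integral>y. f x y \<partial>lborel \<partial>lborel)"
    using lborel_pair.Fubini_integral[OF *] .
qed

section \<open>The Fourier transform of the hyperbolic secant\<close>

text \<open>A Beta integral: \<open>1 / (1 + exp x)\<close> is itself a Gamma integral over
  \<open>w\<close>, at exponent 1 and scale \<open>1 + exp x\<close>. After swapping the order, the
  \<open>x\<close>-integral yields \<open>Gamma s\<close> and the remaining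
  \<open>w\<close>-integral yields \<open>Gamma (1 - s)\<close>.\<close>

lemma has_bochner_integral_logistic:
  fixes s :: complex
  assumes "0 < Re s" "Re s < 1"
  shows "has_bochner_integral lborel (\<lambda>x. exp (s * of_real x) / of_real (1 + exp x))
           (Gamma s * Gamma (1 - s))"
proof -
  let ?f = "\<lambda>w x::real. exp (s * of_real x + of_real (w - exp w * (1 + exp x)))"
  have inner: "has_bochner_integral lborel (\<lambda>x. exp (s * of_real x + of_real (w - exp w * (1 + exp x))))
      (Gamma s * exp ((1 - s) * of_real w - of_real (exp w)))" if "0 < Re s" for s and w :: real
  proof -
    have "exp (s * of_real x - of_real (exp w * exp x)) * exp (of_real (w - exp w)) =
        exp (s * of_real x + of_real (w - exp w * (1 + exp x)))" for x
      by (subst mult_exp_exp, rule arg_cong[of _ _ exp]) (simp add: ring_distribs)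
    moreover have "Gamma s * exp (- s * of_real (ln (exp w))) * exp (of_real (w - exp w)) =
        Gamma s * exp ((1 - s) * of_real w - of_real (exp w))"
      unfolding mult.assoc mult_exp_exp by (simp add: algebra_simps)
    ultimately show ?thesis
      using has_bochner_integral_mult_left[OF has_bochner_integral_Gamma_scaled[OF that, of "exp w"],
          of "exp (of_real (w - exp w))"]
      by (simp only: exp_gt_zero)
  qed
  have outer: "has_bochner_integral lborel (\<lambda>w. ?f w x) (exp (s * of_real x) / of_real (1 + exp x))"
    for x
  proof -
    have pos: "1 + exp x > 0" by (simp add: add_pos_pos)
    have "exp (s * of_real x) * exp (1 * of_real w - of_real ((1 + exp x) * exp w)) = ?f w x" for w
      by (subst mult_exp_exp, rule arg_cong[of _ _ exp]) (simp add: ring_distribs)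
    moreover have "exp (- 1 * complex_of_real (ln (1 + exp x))) = 1 / of_real (1 + exp x)"
      using pos by (simp add: exp_minus exp_of_real field_simps del: of_real_add)
    ultimately show ?thesis
      using has_bochner_integral_mult_right[OF has_bochner_integral_Gamma_scaled[of 1 "1 + exp x"],
          of "exp (s * of_real x)"] pos
      by (simp only: one_complex.simps zero_less_one Gamma_1) simp
  qed
  \<comment> \<open>The norm of the integrand is the same integrand at \<open>Re s\<close>, so the
    formula \<open>inner\<close> also evaluates the integral of norms that Fubini requires.\<close>
  have normf: "exp (of_real (Re s) * of_real x + of_real (w - exp w * (1 + exp x))) =
      complex_of_real (norm (?f w x))" for w x
  proof -
    have n: "norm (?f w x) = exp (Re s * x + (w - exp w * (1 + exp x)))"
      by (simp add: norm_exp_eq_Re)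
    show ?thesis unfolding n by (simp flip: exp_of_real)
  qed
  have inner_norm: "has_bochner_integral lborel (\<lambda>x. norm (?f w x))
      (Gamma (Re s) * exp ((1 - Re s) * w - exp w))" for w
  proof -
    have "exp ((1 - of_real (Re s)) * of_real w - of_real (exp w)) =
        complex_of_real (exp ((1 - Re s) * w - exp w))"
      by (simp flip: exp_of_real)
    thus ?thesis
      using has_bochner_integral_Re[OF inner[of "of_real (Re s)" w, unfolded normf]] assms
      by (simp add: Gamma_complex_of_real)
  qed
  have 1: "case_prod ?f \<in> borel_measurable (borel \<Otimes>\<^sub>M borel)" by measurable
  have 2: "integrable lborel (?f w)" for w
    using inner[OF assms(1)] by (simp add: has_bochner_integral_iff)
  have 3: "integrable lborel (\<lambda>w. \<integral>x. norm (?f w x) \<partial>lborel)"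
    unfolding has_bochner_integral_integral_eq[OF inner_norm]
    using has_bochner_integral_Gamma_real[of "1 - Re s"] assms
    by (simp add: has_bochner_integral_iff)
  have "(\<integral>w. \<integral>x. ?f w x \<partial>lborel \<partial>lborel) = Gamma s * Gamma (1 - s)"
    unfolding has_bochner_integral_integral_eq[OF inner[OF assms(1)]]
    using has_bochner_integral_Gamma[of "1 - s"] assms
    by (simp add: has_bochner_integral_iff)
  then show ?thesis
    using lborel_Fubini[OF 1 2 3]
    unfolding has_bochner_integral_integral_eq[OF outer] has_bochner_integral_iff by simp
qed

lemma sin_pi_times_half_line: "sin (of_real pi * Complex (1/2) t) = of_real (cosh (pi * t))"
proof -
  have "of_real pi * Complex (1/2) t = of_real (pi / 2) + \<i> * of_real (pi * t)"
    by (simp add: complex_eq_iff)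
  hence "sin (of_real pi * Complex (1/2) t) = cos (\<i> * of_real (pi * t))"
    by (simp only: sin_add sin_of_real cos_of_real) simp
  also have "\<dots> = cosh (of_real (pi * t))" by (simp only: cosh_conv_cos)
  finally show ?thesis by (simp add: cosh_field_def flip: exp_of_real)
qed

text \<open>This is the logistic integral at \<open>s = 1/2 + i v / (2 pi)\<close>, where reflection
  gives \<open>pi / cosh (v / 2)\<close>. After scaling \<open>x\<close> by \<open>2 * pi\<close>,
  the factorisation \<open>1 + exp (2 pi x) = 2 exp (pi x) cosh (pi x)\<close> cancels the real part
  of the exponent.\<close>

lemma has_bochner_integral_sech:
  "has_bochner_integral lborel (\<lambda>t. exp (\<i> * of_real (v * t)) / of_real (cosh (pi * t)))
     (of_real (1 / cosh (v / 2)))"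
proof -
  define s where "s = Complex (1/2) (v / (2 * pi))"
  have sin_s: "sin (of_real pi * s) = of_real (cosh (v / 2))"
    using sin_pi_times_half_line[of "v / (2 * pi)"] by (simp add: s_def)
  have "has_bochner_integral lborel (\<lambda>x. exp (s * of_real x) / of_real (1 + exp x))
           (of_real pi / of_real (cosh (v / 2)))"
    using has_bochner_integral_logistic[of s] Gamma_reflection_complex[of s] sin_s by (simp add: s_def)
  hence "has_bochner_integral lborel
          (\<lambda>x. exp (s * of_real (0 + 2 * pi * x)) / of_real (1 + exp (0 + 2 * pi * x)))
           ((of_real pi / of_real (cosh (v / 2))) /\<^sub>R \<bar>2 * pi\<bar>)"
    by (subst (asm) lborel_has_bochner_integral_real_affine_iff[of "2 * pi" _ _ 0]) auto
  from has_bochner_integral_mult_right[OF this, of 2]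
  have "has_bochner_integral lborel
          (\<lambda>x. 2 * (exp (s * of_real (2 * pi * x)) / of_real (1 + exp (2 * pi * x))))
           (of_real (1 / cosh (v / 2)))"
    by (simp add: scaleR_conv_of_real field_simps)
  moreover have "2 * (exp (s * of_real (2 * pi * x)) / of_real (1 + exp (2 * pi * x))) =
      exp (\<i> * of_real (v * x)) / of_real (cosh (pi * x))" for x
  proof -
    have "s * of_real (2 * pi * x) = of_real (pi * x) + \<i> * of_real (v * x)"
      by (simp add: s_def complex_eq_iff)
    moreover have "1 + exp (2 * pi * x) = 2 * exp (pi * x) * cosh (pi * x)"
    proof -
      have "exp (2 * pi * x) = exp (pi * x) * exp (pi * x)" by (simp add: mult_exp_exp)
      thus ?thesis by (simp add: cosh_field_def exp_minus field_simps)
    qed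
    ultimately show ?thesis
      by (simp only: exp_add exp_of_real) simp
  qed
  ultimately show ?thesis by simp
qed

lemma cosh_pi_measurable [measurable]: "(\<lambda>t::real. cosh (pi * t)) \<in> borel_measurable borel"
  by (intro borel_measurable_continuous_onI continuous_intros)

section \<open>From the secant transform to \<open>ln (1 + exp y)\<close>\<close>

text \<open>At \<open>u = 1/2 + i t\<close> this integration is what brings the factor
  \<open>1 / u\<close> into the Mellin-Barnes kernel.\<close>

lemma has_bochner_integral_exp_lessThan:
  fixes u :: complex
  assumes "Re u > 0"
  shows "has_bochner_integral lborel (\<lambda>v. indicator {..<y} v *\<^sub>R exp (u * of_real v)) (exp (u * of_real y) / u)"
proof -
  have "set_integrable lborel (einterval (-\<infinity>) (ereal y)) (\<lambda>v. exp (Re u * v))"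
  proof (rule interval_integral_FTC_nonneg(1)[where F = "\<lambda>v. exp (Re u * v) / Re u"])
    show "(((\<lambda>v. exp (Re u * v) / Re u) \<circ> real_of_ereal) \<longlongrightarrow> 0) (at_right (- \<infinity>))"
      unfolding ereal_tendsto_simps using assms by real_asymp
    show "(((\<lambda>v. exp (Re u * v) / Re u) \<circ> real_of_ereal) \<longlongrightarrow> exp (Re u * y) / Re u) (at_left (ereal y))"
      unfolding ereal_tendsto_simps using assms by (intro tendsto_eq_intros refl) auto
  qed (use assms in \<open>auto intro!: derivative_eq_intros\<close>)
  hence *: "integrable lborel (\<lambda>v. indicator {..<y} v *\<^sub>R exp (u * of_real v))"
    unfolding set_integrable_def
    by (rule Bochner_Integration.integrable_bound) (auto simp: norm_exp_eq_Re indicator_def)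
  have "(LBINT v=-\<infinity>..ereal y. exp (u * of_real v)) = exp (u * of_real y) / u - 0"
  proof (rule interval_integral_FTC_integrable[where F = "\<lambda>v. exp (u * of_real v) / u"])
    have "((\<lambda>v. exp (Re u * v)) \<longlongrightarrow> 0) at_bot"
      using assms by real_asymp
    hence "((\<lambda>v. exp (Re u * v) / norm u) \<longlongrightarrow> 0) at_bot"
      by (rule tendsto_divide_zero)
    hence "((\<lambda>v. norm (exp (u * of_real v) / u)) \<longlongrightarrow> 0) at_bot"
      by (simp add: norm_divide norm_exp_eq_Re)
    thus "(((\<lambda>v. exp (u * of_real v) / u) \<circ> real_of_ereal) \<longlongrightarrow> 0) (at_right (- \<infinity>))"
      unfolding ereal_tendsto_simps by (rule tendsto_norm_zero_cancel)
    show "(((\<lambda>v. exp (u * of_real v) / u) \<circ> real_of_ereal) \<longlongrightarrow> exp (u * of_real y) / u) (at_left (ereal y))"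
      unfolding ereal_tendsto_simps using assms by (intro tendsto_eq_intros refl) auto
    show "((\<lambda>v. exp (u * of_real v) / u) has_vector_derivative exp (u * of_real x)) (at x)" for x
      using assms
      by (auto intro!: has_vector_derivative_real_field derivative_eq_intros)
    show "set_integrable lborel (einterval (- \<infinity>) (ereal y)) (\<lambda>v. exp (u * of_real v))"
      using * by (simp add: set_integrable_def)
  qed (auto intro!: continuous_intros)
  with * show ?thesis
    by (simp add: has_bochner_integral_iff interval_lebesgue_integral_def set_lebesgue_integral_def)
qed

lemma has_bochner_integral_softplus:
  "has_bochner_integral lborel (\<lambda>v. indicator {..<y} v *\<^sub>R (exp v / (1 + exp v))) (ln (1 + exp y :: real))"
proof -
  have pos: "1 + exp v > 0" for v :: real by (simp add: add_pos_pos)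
  have lim_bot: "(((\<lambda>v. ln (1 + exp v :: real)) \<circ> real_of_ereal) \<longlongrightarrow> 0) (at_right (- \<infinity>))"
    unfolding ereal_tendsto_simps by real_asymp
  have lim_y: "(((\<lambda>v. ln (1 + exp v)) \<circ> real_of_ereal) \<longlongrightarrow> ln (1 + exp y)) (at_left (ereal y))"
    unfolding ereal_tendsto_simps using pos[of y]
    by (intro tendsto_eq_intros refl) auto
  have deriv: "((\<lambda>v. ln (1 + exp v)) has_real_derivative exp v / (1 + exp v)) (at v)" for v
    using pos[of v] by (auto intro!: derivative_eq_intros)
  have cont: "isCont (\<lambda>v. exp v / (1 + exp v)) v" for v :: real
    using pos[of v] by (intro continuous_intros) auto
  have nonneg: "AE v in lborel. - \<infinity> < ereal v \<longrightarrow> ereal v < ereal y \<longrightarrow> 0 \<le> exp v / (1 + exp v)"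
    using pos by (auto intro!: divide_nonneg_pos)
  show ?thesis
    using interval_integral_FTC_nonneg[OF _ deriv cont nonneg lim_bot lim_y]
    by (simp add: has_bochner_integral_iff interval_lebesgue_integral_def set_lebesgue_integral_def set_integrable_def)
qed

text \<open>The kernel of the inverse Mellin transform of \<open>ln (1 + x)\<close> on the line \<open>Re u = 1/2\<close>,
  where \<open>sin (pi * u) = cosh (pi * t)\<close>.\<close>

definition softplus_kernel :: "real \<Rightarrow> complex" where
  "softplus_kernel t = 1 / (2 * Complex (1/2) t * of_real (cosh (pi * t)))"

lemma softplus_kernel_measurable [measurable]: "softplus_kernel \<in> borel_measurable borel"
proof -
  have "Complex (1/2) t \<noteq> 0" for t by (simp add: complex_eq_iff)
  moreover have "cosh (pi * t) \<noteq> 0" for t using cosh_real_pos[of "pi * t"] by simp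
  ultimately show ?thesis
    unfolding softplus_kernel_def Complex_eq
    by (intro borel_measurable_continuous_onI continuous_intros) (auto simp: complex_eq_iff)
qed

text \<open>The secant transform at frequency 0.\<close>

lemma integrable_sech: "integrable lborel (\<lambda>t. 1 / cosh (pi * t))"
  and integral_sech: "(\<integral>t. 1 / cosh (pi * t) \<partial>lborel) = 1"
  using has_bochner_integral_Re[OF has_bochner_integral_sech[of 0]] 
  by (simp_all add: has_bochner_integral_iff)

lemma norm_softplus_kernel_le: "norm (softplus_kernel t) \<le> 1 / cosh (pi * t)"
proof -
  have "1/2 \<le> norm (Complex (1/2) t)"
    using abs_Re_le_cmod[of "Complex (1/2) t"] by simp
  moreover have "cosh (pi * t) > 0" by simp
  ultimately show ?thesis
    by (simp add: softplus_kernel_def norm_divide norm_mult divide_simps)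
qed

lemma integrable_softplus_kernel: "integrable lborel softplus_kernel"
  by (rule Bochner_Integration.integrable_bound[OF integrable_sech])
     (auto intro: order_trans[OF norm_softplus_kernel_le])

text \<open>The logistic function \<open>exp v / (1 + exp v)\<close> is \<open>exp (v/2) / 2\<close>
  times \<open>1 / cosh (v/2)\<close>. Expanding the latter as a Fourier integral in
  \<open>t\<close> and integrating over \<open>v < y\<close> gives \<open>ln (1 + exp y)\<close>;
  integrating over \<open>v\<close> first gives the kernel.\<close>

lemma softplus_eq_integral:
  "has_bochner_integral lborel (\<lambda>t. softplus_kernel t * exp (Complex (1/2) t * of_real y))
     (of_real (ln (1 + exp y)))"
proof -
  let ?f = "\<lambda>v t::real. indicator {..<y} v *\<^sub>R
     (exp (Complex (1/2) t * of_real v) / (2 * of_real (cosh (pi * t))))"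
  have split: "exp (Complex (1/2) t * of_real v) = of_real (exp (v/2)) * exp (\<i> * of_real (v * t))" for v t
    by (simp add: Complex_eq algebra_simps exp_add flip: exp_of_real)
  have inner: "has_bochner_integral lborel (?f v) (of_real (indicator {..<y} v *\<^sub>R (exp v / (1 + exp v))))" for v
  proof -
    have "exp (v/2) * exp (v/2) = exp v" by (simp add: mult_exp_exp)
    hence "exp (v / 2) / 2 * (1 / cosh (v / 2)) = exp v / (1 + exp v)"
      by (simp add: cosh_field_def exp_minus divide_simps add_nonneg_eq_0_iff)
    hence "of_real (indicator {..<y} v * (exp (v/2) / 2)) * of_real (1 / cosh (v / 2)) =
        complex_of_real (indicator {..<y} v *\<^sub>R (exp v / (1 + exp v)))"
      unfolding of_real_mult[symmetric] by (simp only: mult.assoc real_scaleR_def)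
    moreover have "of_real (indicator {..<y} v * (exp (v/2) / 2)) *
        (exp (\<i> * of_real (v * t)) / of_real (cosh (pi * t))) = ?f v t" for t
      by (simp add: split scaleR_conv_of_real)
    ultimately show ?thesis
      using has_bochner_integral_mult_right[OF has_bochner_integral_sech[of v],
         of "of_real (indicator {..<y} v * (exp (v/2) / 2))"]
      by (simp only:)
  qed
  have norm_inner: "has_bochner_integral lborel (\<lambda>t. norm (?f v t)) (indicator {..<y} v *\<^sub>R (exp (v/2) / 2))" for v
  proof -
    have "norm (?f v t) = indicator {..<y} v *\<^sub>R (exp (v/2) / 2) * (1 / cosh (pi * t))" for t
      by (simp add: norm_mult norm_divide norm_exp_eq_Re indicator_def)
    thus ?thesis
      using has_bochner_integral_mult_right[of "indicator {..<y} v *\<^sub>R (exp (v/2) / 2)" lborel "\<lambda>t. 1 / cosh (pi * t)" 1]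
      by (simp add: has_bochner_integral_iff integrable_sech integral_sech)
  qed
  have outer: "has_bochner_integral lborel (\<lambda>v. ?f v t) (softplus_kernel t * exp (Complex (1/2) t * of_real y))" for t
    using has_bochner_integral_mult_left[OF has_bochner_integral_exp_lessThan[of "Complex (1/2) t" y],
        of "1 / (2 * of_real (cosh (pi * t)))"]
    by (simp add: softplus_kernel_def mult_ac)
  have 1: "case_prod ?f \<in> borel_measurable (borel \<Otimes>\<^sub>M borel)"
    unfolding Complex_eq by measurable
  have 2: "integrable lborel (?f v)" for v
    using inner[of v] by (simp add: has_bochner_integral_iff)
  \<comment> \<open>Since \<open>1 / cosh (pi * t)\<close> has total mass 1, the inner norm integral
    is \<open>exp (v/2) / 2\<close> on \<open>v < y\<close>; its integrability is the case
    \<open>u = 1/2\<close> of the exponential integral.\<close>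
  have 3: "integrable lborel (\<lambda>v. \<integral>t. norm (?f v t) \<partial>lborel)"
  proof -
    have "integrable lborel (\<lambda>v. indicator {..<y} v *\<^sub>R exp (1/2 * of_real v) :: complex)"
      using has_bochner_integral_exp_lessThan[of "1/2" y] by (simp add: has_bochner_integral_iff)
    moreover have "norm (indicator {..<y} v *\<^sub>R exp (1/2 * of_real v) :: complex) =
        2 * (indicator {..<y} v *\<^sub>R (exp (v/2) / 2))" for v
      by (simp add: norm_exp_eq_Re)
    ultimately have "integrable lborel (\<lambda>v. 2 * (indicator {..<y} v *\<^sub>R (exp (v/2) / 2)))"
      using integrable_norm[of lborel "\<lambda>v. indicator {..<y} v *\<^sub>R exp (1/2 * of_real v) :: complex"]
      by (simp only:)
    thus ?thesis
      unfolding has_bochner_integral_integral_eq[OF norm_inner] by simp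
  qed
  have "(\<integral>v. \<integral>t. ?f v t \<partial>lborel \<partial>lborel) = of_real (ln (1 + exp y))"
    unfolding has_bochner_integral_integral_eq[OF inner]
    by (simp only: integral_complex_of_real has_bochner_integral_integral_eq[OF has_bochner_integral_softplus])
  then show ?thesis
    using lborel_Fubini[OF 1 2 3]
    unfolding has_bochner_integral_integral_eq[OF outer] has_bochner_integral_iff by simp
qed

text \<open>The representation of the logarithm is inserted at \<open>y + r * x\<close>; after the
  exchange the \<open>x\<close>-integral is a Gamma integral at \<open>\<mu> + r u\<close>. On
  \<open>Re u = 1/2\<close> the norms integrate in \<open>x\<close> to a constant times the norm of
  the integrable kernel.\<close>

lemma integral_Gamma_softplus:
  assumes "\<mu> > 0" "r > 0"
  shows "(\<integral>t. Gamma (of_real \<mu> + of_real r * Complex (1/2) t) * softplus_kernel t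
                * exp (Complex (1/2) t * of_real y) \<partial>lborel)
       = of_real (\<integral>x. exp (\<mu> * x - exp x) * ln (1 + exp (y + r * x)) \<partial>lborel)"
proof -
  let ?f = "\<lambda>t x::real. softplus_kernel t * exp (Complex (1/2) t * of_real (y + r * x)) *
      of_real (exp (\<mu> * x - exp x))"
  have inner: "has_bochner_integral lborel (?f t)
     (Gamma (of_real \<mu> + of_real r * Complex (1/2) t) * softplus_kernel t
                * exp (Complex (1/2) t * of_real y))" for t
  proof -
    have "exp ((of_real \<mu> + of_real r * Complex (1/2) t) * of_real x - of_real (exp x)) * 
       (softplus_kernel t * exp (Complex (1/2) t * of_real y)) = ?f t x" for x
    proof -
      have "exp ((of_real \<mu> + of_real r * Complex (1/2) t) * of_real x - of_real (exp x)) * exp (Complex (1/2) t * of_real y)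
       = exp (Complex (1/2) t * of_real (y + r * x)) * exp (of_real (\<mu> * x - exp x))"
        by (subst (1 2) mult_exp_exp, rule arg_cong[of _ _ exp]) (simp add: algebra_simps)
      thus ?thesis by (simp only: exp_of_real mult_ac)
    qed
    moreover have "Re (of_real \<mu> + of_real r * Complex (1/2) t) > 0"
      using assms by (simp add: add_pos_pos)
    ultimately have "has_bochner_integral lborel (?f t)
        (Gamma (of_real \<mu> + of_real r * Complex (1/2) t) *
          (softplus_kernel t * exp (Complex (1/2) t * of_real y)))"
      using has_bochner_integral_mult_left[OF has_bochner_integral_Gamma[of "of_real \<mu> + of_real r * Complex (1/2) t"],
         of "softplus_kernel t * exp (Complex (1/2) t * of_real y)"]
      by (simp only:)
    thus ?thesis by (simp only: mult.assoc)
  qed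
  have norm_inner: "has_bochner_integral lborel (\<lambda>x. norm (?f t x))
     (Gamma (\<mu> + r/2) * exp (y/2) * norm (softplus_kernel t))" for t
  proof -
    have "norm (?f t x) = exp ((\<mu> + r/2) * x - exp x) * (exp (y/2) * norm (softplus_kernel t))" for x
    proof -
      have "exp ((y + r * x) / 2) * exp (\<mu> * x - exp x) = exp ((\<mu> + r/2) * x - exp x) * exp (y/2)"
        by (subst (1 2) mult_exp_exp, rule arg_cong[of _ _ exp]) (simp add: field_simps)
      thus ?thesis
        by (simp add: norm_mult norm_exp_eq_Re)
    qed
    thus ?thesis
      using has_bochner_integral_mult_left[OF has_bochner_integral_Gamma_real[of "\<mu> + r/2"], of "exp (y/2) * norm (softplus_kernel t)"] assms
      by (simp add: mult_ac)
  qed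
  have outer: "has_bochner_integral lborel (\<lambda>t. ?f t x)
      (of_real (exp (\<mu> * x - exp x) * ln (1 + exp (y + r * x))))" for x
    using has_bochner_integral_mult_left[OF softplus_eq_integral[of "y + r * x"],
        of "of_real (exp (\<mu> * x - exp x))"]
    by (simp add: mult_ac)
  have 1: "case_prod ?f \<in> borel_measurable (borel \<Otimes>\<^sub>M borel)"
    unfolding Complex_eq by measurable
  have 2: "integrable lborel (?f t)" for t
    using inner[of t] by (simp add: has_bochner_integral_iff)
  have 3: "integrable lborel (\<lambda>t. \<integral>x. norm (?f t x) \<partial>lborel)"
    unfolding has_bochner_integral_integral_eq[OF norm_inner]
    using integrable_softplus_kernel by simp
  show ?thesis
    using lborel_Fubini(2)[OF 1 2 3]
    unfolding has_bochner_integral_integral_eq[OF inner] has_bochner_integral_integral_eq[OF outer]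
    by (simp only: integral_complex_of_real)
qed

section \<open>The Gauss multiplication formula\<close>

text \<open>Dividing \<open>x^n - 1 = prod (x - w^k)\<close> by \<open>x - 1\<close> and setting
  \<open>x = 1\<close> gives \<open>n\<close> as the product of the \<open>1 - w^k\<close> with
  \<open>0 < k < n\<close>, and the norm of \<open>1 - w^k\<close> is
  \<open>2 sin (pi k / n)\<close>.\<close>

lemma prod_sin_pi_div:
  assumes "n > 0"
  shows "(\<Prod>k=1..<n. sin (pi * real k / real n)) = real n / 2 ^ (n - 1)"
proof -
  define w where "w = cis (2 * pi / real n)"
  have wk: "w ^ k = cis (2 * pi * real k / real n)" for k
    by (simp add: w_def Complex.DeMoivre mult_ac)
  have bij: "bij_betw (\<lambda>k. w ^ k) {..<n} {z. z ^ n = 1}"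
    using Complex.bij_betw_roots_unity[OF assms] unfolding wk by simp
  have fin: "finite {z::complex. z ^ n = 1}" using assms by (intro finite_roots_unity) auto
  have sumprod: "(\<Prod>z\<in>{z. z ^ n = 1} - {1::complex}. [:-z, 1:]) = (\<Sum>i<n. monom 1 i)"
  proof -
    let ?P = "monom 1 n - 1 :: complex poly" and ?Q = "\<Prod>z\<in>{z::complex. z ^ n = 1}. [:-z, 1:]"
    have deg: "degree ?P = n" 
      unfolding diff_conv_add_uminus using assms
      by (subst degree_add_eq_left) (auto simp: degree_monom_eq)
    have degQ: "degree ?Q = n"
      using card_roots_unity_eq[OF assms] by (subst degree_prod_eq_sum_degree) auto
    \<comment> \<open>Both polynomials are monic of degree \<open>n\<close>, so a nonzero difference
      would have degree below \<open>n\<close> while vanishing at all \<open>n\<close> roots of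
      unity.\<close>
    have "?Q = ?P"
    proof (rule ccontr)
      assume neq: "?Q \<noteq> ?P"
      have cQ: "coeff ?Q n = 1" 
        using lead_coeff_prod[of "\<lambda>z. [:-z, 1:]" "{z::complex. z ^ n = 1}"] degQ by simp
      have cP: "coeff ?P n = 1" using assms by simp
      have "degree (?Q - ?P) < n"
      proof -
        have "degree (?Q - ?P) \<le> n" by (rule degree_diff_le) (simp_all only: deg degQ)
        moreover have "coeff (?Q - ?P) n = 0" using cQ cP by simp
        moreover have "?Q - ?P \<noteq> 0" using neq by simp
        ultimately show ?thesis
          using leading_coeff_0_iff[of "?Q - ?P"] by (metis le_neq_implies_less)
      qed
      moreover have "{z. z ^ n = 1} \<subseteq> {z. poly (?Q - ?P) z = 0}"
        using fin by (auto simp: poly_prod poly_monom)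
      hence "card {z::complex. z ^ n = 1} \<le> card {z. poly (?Q - ?P) z = 0}"
        using neq by (intro card_mono poly_roots_finite) auto
      moreover have "card {z. poly (?Q - ?P) z = 0} \<le> degree (?Q - ?P)"
        using neq by (intro card_poly_roots_bound) auto
      ultimately show False using card_roots_unity_eq[OF assms] by linarith
    qed
    moreover have "?Q = [:-1, 1:] * (\<Prod>z\<in>{z. z ^ n = 1} - {1::complex}. [:-z, 1:])"
      using fin by (subst prod.remove[of _ 1]) auto
    moreover have "?P = [:-1, 1:] * (\<Sum>i<n. monom 1 i)"
    proof -
      have m: "monom (1::complex) i = [:0, 1:] ^ i" for i by (simp add: monom_altdef)
      have "[:0, 1::complex:] - 1 = [:-1, 1:]" by (simp add: one_pCons)
      thus ?thesis using power_diff_1_eq[of "[:0, 1::complex:]" n] by (simp add: m)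
    qed
    ultimately have "[:-1, 1:] * (\<Prod>z\<in>{z. z ^ n = 1} - {1::complex}. [:-z, 1:]) =
        [:-1, 1:] * (\<Sum>i<n. monom 1 i)"
      by (simp only:)
    thus ?thesis by (subst (asm) mult_cancel_left) auto
  qed
  have "(\<Prod>z\<in>{z. z ^ n = 1} - {1::complex}. 1 - z) = of_nat n"
    using arg_cong[OF sumprod, of "\<lambda>p. poly p 1"] by (simp add: poly_prod poly_sum poly_monom)
  also have "(\<Prod>z\<in>{z. z ^ n = 1} - {1::complex}. 1 - z) = (\<Prod>k\<in>{1..<n}. 1 - w ^ k)"
  proof -
    have "bij_betw (\<lambda>k. w ^ k) ({..<n} - {0}) ({z. z ^ n = 1} - {1})"
      using bij_betw_DiffI[OF bij, of "{0}" "{1}"] assms by (auto simp: bij_betw_def)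
    moreover have "{..<n} - {0} = {1..<n}" by auto
    ultimately show ?thesis by (simp add: prod.reindex_bij_betw[of _ _ _ "\<lambda>z. 1 - z", symmetric])
  qed
  finally have "norm (\<Prod>k\<in>{1..<n}. 1 - w ^ k) = real n" by simp
  moreover have "norm (1 - w ^ k) = 2 * sin (pi * real k / real n)" if "k \<in> {1..<n}" for k
  proof -
    define x where "x = pi * real k / real n"
    have "0 \<le> x" "x \<le> pi" using that by (auto simp: x_def field_simps)
    hence "sin x \<ge> 0" by (intro sin_ge_zero) auto
    have "1 - w ^ k = - 2 * \<i> * of_real (sin x) * cis x"
      unfolding wk by (simp add: complex_eq_iff x_def[symmetric] flip: mult.assoc times_divide_eq_right)
        (use cos_double_sin[of x] sin_double[of x] in \<open>auto simp: x_def power2_eq_square mult_ac\<close>)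
    hence "norm (1 - w ^ k) = 2 * \<bar>sin x\<bar>" by (simp add: norm_mult)
    with \<open>sin x \<ge> 0\<close> show ?thesis by (simp add: x_def)
  qed
  ultimately have "(\<Prod>k\<in>{1..<n}. 2 * sin (pi * real k / real n)) = real n"
    by (simp add: prod_norm[symmetric])
  thus ?thesis by (simp add: prod.distrib field_simps)
qed

text \<open>Factors are grouped by residue modulo \<open>n\<close>:
  \<open>n z + n m + i = n (z + i / n + m)\<close>, with one block of \<open>n\<close> factors per
  induction step.\<close>

lemma pochhammer_mult_nat:
  fixes z :: "'a :: field_char_0"
  assumes "n > 0"
  shows "pochhammer (of_nat n * z) (n * m) =
           of_nat n ^ (n * m) * (\<Prod>i<n. pochhammer (z + of_nat i / of_nat n) m)"
proof (induction m)
  case (Suc m)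
  have "pochhammer (of_nat n * z) (n * Suc m) = pochhammer (of_nat n * z) (n * m + n)"
    by (simp add: add.commute)
  also have "\<dots> = pochhammer (of_nat n * z) (n * m) * pochhammer (of_nat n * z + of_nat (n * m)) n"
    by (rule pochhammer_product')
  also have "pochhammer (of_nat n * z + of_nat (n * m)) n = 
      (\<Prod>i<n. of_nat n * (z + of_nat i / of_nat n + of_nat m))"
    unfolding pochhammer_prod atLeast0LessThan using assms
    by (intro prod.cong) (auto simp: field_simps)
  also have "\<dots> = of_nat n ^ n * (\<Prod>i<n. z + of_nat i / of_nat n + of_nat m)"
    by (simp add: prod.distrib)
  finally show ?case
    using Suc.IH by (simp add: power_add prod.distrib pochhammer_rec' mult_ac)
qed auto

lemma complex_pos_notin_nonpos_Ints: "z \<notin> \<int>\<^sub>\<le>\<^sub>0" if "Re z > 0" for z :: complex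
  using that by (auto elim!: nonpos_Ints_cases')

text \<open>The quotient of the two sides is the limit of an expression free of \<open>z\<close>; its value
  is read off at \<open>z = 1 / n\<close>.\<close>

lemma Gamma_mult_aux:
  fixes z :: complex
  assumes "n > 0" "Re z > 0"
  shows "(\<lambda>m. fact (m - 1) ^ n / fact (n * m - 1) * of_nat n ^ (n * m) *
              exp (of_real (ln (real m) * (real n - 1) / 2)) :: complex)
         \<longlonglongrightarrow> exp (of_nat n * z * of_real (ln (real n))) * (\<Prod>i<n. Gamma (z + of_nat i / of_nat n)) / Gamma (of_nat n * z)"
    (is "?h \<longlonglongrightarrow> _")
proof -
  \<comment> \<open>The denominator runs along the subsequence \<open>n * m\<close>, so that its
    \<open>n * m\<close> Pochhammer factors match the \<open>n\<close> symbols of length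
    \<open>m\<close> in the numerator product.\<close>
  let ?g = "\<lambda>m. exp (of_nat n * z * of_real (ln (real n))) *
     (\<Prod>i<n. Gamma_series' (z + of_nat i / of_nat n) m) / Gamma_series' (of_nat n * z) (n * m)"
  have nz: "of_nat n * z \<notin> \<int>\<^sub>\<le>\<^sub>0"
    using assms by (intro complex_pos_notin_nonpos_Ints) simp
  have nzi: "pochhammer (z + of_nat i / of_nat n) m \<noteq> 0" for i m
  proof
    assume "pochhammer (z + of_nat i / of_nat n) m = 0"
    then obtain k where "z + of_nat i / of_nat n = - of_nat k" by (auto simp: pochhammer_eq_0_iff)
    from arg_cong[OF this, of Re] have "Re z + real i / real n = - real k" by simp
    moreover have "real i / real n \<ge> 0" "real k \<ge> 0" by simp_all
    ultimately show False using assms(2) by linarith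
  qed
  have "?g \<longlonglongrightarrow> exp (of_nat n * z * of_real (ln (real n))) * (\<Prod>i<n. Gamma (z + of_nat i / of_nat n)) / Gamma (of_nat n * z)"
    using LIMSEQ_subseq_LIMSEQ[OF Gamma_series'_LIMSEQ, of "(*) n" "of_nat n * z"] nz assms
    by (intro tendsto_intros Gamma_series'_LIMSEQ)
       (simp_all add: o_def strict_mono_def Gamma_eq_zero_iff)
  moreover have "eventually (\<lambda>m. ?g m = ?h m) sequentially"
    using eventually_gt_at_top[of 0]
  proof eventually_elim
    fix m :: nat assume m: "m > 0"
    \<comment> \<open>\<open>E\<close>, \<open>N\<close> and \<open>P\<close> carry all dependence
      on \<open>z\<close> and cancel in the quotient \<open>?g\<close>.\<close>
    define E where "E = exp (of_nat n * z * of_real (ln (real m)))"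
    define N where "N = exp (of_nat n * z * of_real (ln (real n)))"
    define P where "P = (\<Prod>i<n. pochhammer (z + of_nat i / of_nat n) m)"
    have P: "P \<noteq> 0" unfolding P_def using nzi by simp
    have sum_i: "(\<Sum>i<n. real i / real n) = (real n - 1) / 2"
    proof -
      have "(\<Sum>i<n. real i) = real n * (real n - 1) / 2"
        by (induction n) (auto simp: field_simps)
      thus ?thesis using assms by (simp add: field_simps flip: sum_divide_distrib)
    qed
    have "(\<Prod>i<n. Gamma_series' (z + of_nat i / of_nat n) m) = 
        fact (m - 1) ^ n * (\<Prod>i<n. exp ((z + of_nat i / of_nat n) * of_real (ln (real m)))) / P"
      by (simp add: Gamma_series'_def prod_dividef prod.distrib P_def)
    also have "(\<Prod>i<n. exp ((z + of_nat i / of_nat n) * of_real (ln (real m)))) =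
        exp ((\<Sum>i<n. z + of_nat i / of_nat n) * of_real (ln (real m)))"
      by (simp add: exp_sum sum_distrib_right)
    also have "(\<Sum>i<n. z + of_nat i / of_nat n) = of_nat n * z + of_real ((real n - 1) / 2)"
      unfolding sum_i[symmetric] by (simp add: sum.distrib)
    also have "exp ((of_nat n * z + of_real ((real n - 1) / 2)) * of_real (ln (real m))) =
       E * exp (of_real (ln (real m) * (real n - 1) / 2))"
      unfolding E_def exp_add[symmetric] by (simp add: algebra_simps)
    finally have 1: "(\<Prod>i<n. Gamma_series' (z + of_nat i / of_nat n) m) = 
        fact (m - 1) ^ n * (E * exp (of_real (ln (real m) * (real n - 1) / 2))) / P" .
    have ln_nm: "ln (real (n * m)) = ln (real n) + ln (real m)"
      using m assms by (simp add: ln_mult)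
    have 2: "Gamma_series' (of_nat n * z) (n * m) = fact (n * m - 1) * (N * E) / (of_nat n ^ (n * m) * P)"
      unfolding Gamma_series'_def pochhammer_mult_nat[OF assms(1)] N_def E_def exp_add[symmetric] ln_nm P_def
      by (simp add: ring_distribs)
    have [simp]: "E \<noteq> 0" "N \<noteq> 0" by (auto simp: E_def N_def)
    show "?g m = ?h m"
      unfolding 1 2 N_def[symmetric] using P assms by (simp add: field_simps)
  qed
  ultimately show ?thesis by (blast intro: Lim_transform_eventually)
qed

lemma Gamma_reflection_of_real: "Gamma x * Gamma (1 - x) = pi / sin (pi * x)" for x :: real
proof -
  have "complex_of_real (Gamma x * Gamma (1 - x)) = of_real (pi / sin (pi * x))"
    using Gamma_reflection_complex[of "of_real x"] Gamma_complex_of_real[of "1 - x"]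
    by (simp add: Gamma_complex_of_real sin_of_real flip: of_real_mult)
  thus ?thesis by (simp only: of_real_eq_iff)
qed

text \<open>Equality of the limits at \<open>z\<close> and at \<open>1 / n\<close> leaves the
  product of the \<open>Gamma (k / n)\<close>. Its square is evaluated by pairing \<open>k\<close>
  with \<open>n - k\<close>: reflection turns each pair into
  \<open>pi / sin (pi k / n)\<close>.\<close>

theorem Gamma_multiplication:
  fixes z :: complex
  assumes "n > 0" "Re z > 0"
  shows "(\<Prod>i<n. Gamma (z + of_nat i / of_nat n)) =
    of_real ((2 * pi) powr ((real n - 1) / 2)) * exp ((1 / 2 - of_nat n * z) * of_real (ln (real n))) * Gamma (of_nat n * z)"
proof -
  let ?L = "\<lambda>z. exp (of_nat n * z * of_real (ln (real n))) * (\<Prod>i<n. Gamma (z + of_nat i / of_nat n)) / Gamma (of_nat n * z)"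
  have "?L z = ?L (of_real (1 / real n))"
    using assms by (intro LIMSEQ_unique[OF Gamma_mult_aux Gamma_mult_aux]) auto
  also have "\<dots> = of_real (real n * (\<Prod>i<n. Gamma (real (Suc i) / real n)))"
  proof -
    have "complex_of_real (1 / real n) + of_nat i / of_nat n = of_real (real (Suc i) / real n)" for i
      by (simp add: add_divide_distrib)
    moreover have "of_nat n * complex_of_real (1 / real n) = 1" using assms by simp
    ultimately show ?thesis using assms
      by (simp only: Gamma_complex_of_real) (simp add: exp_of_real)
  qed
  also have "real n * (\<Prod>i<n. Gamma (real (Suc i) / real n)) = sqrt (real n) * (2 * pi) powr ((real n - 1) / 2)"
  proof -
    define Q where "Q = (\<Prod>i=1..<n. Gamma (real i / real n))"
    have Q0: "Q > 0" unfolding Q_def using assms by (intro prod_pos) (auto intro!: Gamma_real_pos)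
    have "Q = (\<Prod>i=1..<n. Gamma (1 - real i / real n))"
      unfolding Q_def using assms
      by (intro prod.reindex_bij_witness[of _ "\<lambda>i. n - i" "\<lambda>i. n - i"]) (auto simp: of_nat_diff field_simps)
    hence "Q ^ 2 = (\<Prod>i=1..<n. Gamma (real i / real n) * Gamma (1 - real i / real n))"
      by (simp add: power2_eq_square prod.distrib Q_def)
    also have "\<dots> = (\<Prod>i=1..<n. pi / sin (pi * real i / real n))"
      by (intro prod.cong) (simp_all add: Gamma_reflection_of_real)
    also have "\<dots> = pi ^ (n - 1) / (\<Prod>i=1..<n. sin (pi * real i / real n))"
      by (simp add: prod_dividef)
    also have "\<dots> = (2 * pi) ^ (n - 1) / real n"
      using assms by (subst prod_sin_pi_div) (auto simp: power_mult_distrib)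
    also have "\<dots> = ((2 * pi) powr ((real n - 1) / 2) / sqrt (real n)) ^ 2"
    proof -
      have "((2 * pi) powr ((real n - 1) / 2)) ^ 2 = (2 * pi) powr real (n - 1)"
        using assms by (simp add: powr_power of_nat_diff diff_divide_distrib)
      also have "\<dots> = (2 * pi) ^ (n - 1)" by (intro powr_realpow) auto
      finally show ?thesis using assms by (simp add: power_divide)
    qed
    finally have "Q = (2 * pi) powr ((real n - 1) / 2) / sqrt (real n)"
      using Q0 by (subst (asm) power2_eq_iff_nonneg) auto
    moreover have "(\<Prod>i<n. Gamma (real (Suc i) / real n)) = Q"
    proof -
      \<comment> \<open>After the shift to \<open>1..n\<close>, the extra factor at \<open>n\<close>
        is \<open>Gamma 1 = 1\<close>.\<close>
      have "(\<Prod>i<n. Gamma (real (Suc i) / real n)) = (\<Prod>i=1..n. Gamma (real i / real n))"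
        by (rule prod.reindex_bij_witness[of _ "\<lambda>i. i - 1" Suc]) auto
      also have "{1..n} = insert n {1..<n}" using assms by auto
      finally show ?thesis using assms by (simp add: Q_def)
    qed
    moreover have "real n / sqrt (real n) = sqrt (real n)" by (rule real_div_sqrt) simp
    ultimately show ?thesis by (metis times_divide_eq_left times_divide_eq_right)
  qed
  finally have *: "?L z = of_real (sqrt (real n) * (2 * pi) powr ((real n - 1) / 2))" .
  have nz: "Gamma (of_nat n * z) \<noteq> 0"
    using assms complex_pos_notin_nonpos_Ints[of "of_nat n * z"] by (simp add: Gamma_eq_zero_iff)
  define X where "X = exp (of_nat n * z * complex_of_real (ln (real n)))"
  have "complex_of_real (sqrt (real n)) = exp (1 / 2 * of_real (ln (real n)))"
  proof -
    have "sqrt (real n) = exp (1 / 2 * ln (real n))"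
      using assms by (simp add: powr_half_sqrt[symmetric] powr_def)
    thus ?thesis by (simp flip: exp_of_real)
  qed
  hence sqrt_n: "exp ((1 / 2 - of_nat n * z) * of_real (ln (real n))) = of_real (sqrt (real n)) / X"
    by (simp add: X_def exp_diff left_diff_distrib)
  have "X \<noteq> 0" by (simp add: X_def)
  thus ?thesis
    using *[folded X_def] nz unfolding sqrt_n by (simp add: divide_simps mult_ac)
qed

section \<open>The Meijer G-function\<close>

lemma prod_nth_eq_prod_list: "(\<Prod>j<length xs. f (xs ! j)) = prod_list (map f xs)"
  by (simp add: prod.list_conv_set_nth atLeast0LessThan)

lemma length_Delta [simp]: "length (Delta n b) = n"
  by (simp add: Delta_def)

lemma nth_Delta [simp]: "i < n \<Longrightarrow> Delta n b ! i = (b + real i) / real n"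
  by (simp add: Delta_def)

lemma prod_list_Delta: "prod_list (map f (Delta n b)) = (\<Prod>i<n. f ((b + real i) / real n))"
  by (simp add: Delta_def o_def prod.list_conv_set_nth atLeast0LessThan)

text \<open>The leftmost pole of one family is at 0, the rightmost pole of the other at
  \<open>(p - 1) / p - 1 = - 1 / p\<close>. Under \<open>s = - u / p\<close> the vertical line
  through the midpoint becomes \<open>Re u = 1/2\<close>.\<close>

lemma meijerG_abscissa_capacity:
  assumes "p > 0" "\<mu> > 0"
  shows "meijerG_abscissa (q + p + 1) p (Delta p 0 @ [1]) (Delta p 0 @ Delta q \<mu> @ [0]) = - 1 / (2 * real p)"
proof -
  let ?as = "Delta p 0 @ [1]" and ?bs = "Delta p 0 @ Delta q \<mu> @ [0]"
  have "(\<lambda>j. ?bs ! j) ` {..<q + p + 1} = set ?bs"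
    unfolding set_conv_nth by (auto simp: image_iff)
  moreover have "Min (set ?bs) = 0"
    using assms by (intro Min_eqI) (auto simp: Delta_def)
  moreover have "Max ((\<lambda>j. ?as ! j - 1) ` {..<p}) = - 1 / real p"
  proof (intro Max_eqI)
    show "- 1 / real p \<in> (\<lambda>j. ?as ! j - 1) ` {..<p}"
      using assms by (intro image_eqI[of _ _ "p - 1"]) (auto simp: nth_append of_nat_diff field_simps)
  next
    fix x assume "x \<in> (\<lambda>j. ?as ! j - 1) ` {..<p}"
    then obtain j where j: "j < p" "x = (real j - real p) / real p"
      by (auto simp: nth_append diff_divide_distrib)
    thus "x \<le> - 1 / real p" unfolding j(2) by (intro divide_right_mono) auto
  qed auto
  ultimately show ?thesis using assms
    by (simp add: meijerG_abscissa_def Let_def)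
qed

text \<open>Under \<open>s = - u / p\<close> the multiplication formula merges the lower block
  \<open>Delta p 0\<close> into \<open>Gamma u\<close>, the upper one into
  \<open>Gamma (1 - u)\<close> and \<open>Delta q \<mu>\<close> into
  \<open>Gamma (\<mu> + q u / p)\<close>. The parameters 0 and 1 leave
  \<open>Gamma (- s) / Gamma (1 - s) = p / u\<close>. The form of \<open>ln z\<close> cancels the
  powers of \<open>q\<close> that depend on \<open>u\<close>.\<close>

lemma meijerG_integrand_capacity:
  assumes "p > 0" "q > 0" "\<mu> > 0" and z: "ln z = - real q * ln (real q) - real p * y"
  defines "u \<equiv> \<lambda>t. Complex (1/2) t"
  shows "meijerG_integrand (q + p + 1) p (Delta p 0 @ [1]) (Delta p 0 @ Delta q \<mu> @ [0]) z
           (Complex (- 1 / (2 * real p)) t)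
       = of_real (2 * pi * real p * (2 * pi) powr ((real q - 3) / 2 + real p) * real q powr (1/2 - \<mu>)) *
         (Gamma (of_real \<mu> + of_real (real q / real p) * u (- real p * t)) * softplus_kernel (- real p * t) *
           exp (u (- real p * t) * of_real y))"
proof -
  define v where "v = u (- real p * t)"
  define s where "s = Complex (- 1 / (2 * real p)) t"
  have s: "s = - v / of_nat p" using assms by (simp add: s_def v_def u_def complex_eq_iff)
  have Re_v: "Re v = 1/2" by (simp add: v_def u_def)
  hence v0: "v \<noteq> 0" by auto
  have np: "of_nat p \<noteq> (0::complex)" and nq: "of_nat q \<noteq> (0::complex)" using assms by auto
  let ?as = "Delta p 0 @ [1]" and ?bs = "Delta p 0 @ Delta q \<mu> @ [0]"
  \<comment> \<open>All lower parameters belong to the numerator, so this product covers the whole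
    list \<open>?bs\<close>.\<close>
  have "(\<Prod>j<q+p+1. Gamma (of_real (?bs ! j) - s)) =
      prod_list (map (\<lambda>b. Gamma (of_real b - s)) ?bs)"
    using prod_nth_eq_prod_list[of "\<lambda>b. Gamma (of_real b - s)" ?bs] by (simp add: add_ac)
  also have "\<dots> = (\<Prod>i<p. Gamma (v / of_nat p + of_nat i / of_nat p)) *
      (\<Prod>i<q. Gamma ((of_real \<mu> / of_nat q + v / of_nat p) + of_nat i / of_nat q)) * Gamma (v / of_nat p)"
    by (simp add: prod_list_Delta s add_divide_distrib add_ac)
  also have "(\<Prod>i<p. Gamma (v / of_nat p + of_nat i / of_nat p)) =
       of_real ((2 * pi) powr ((real p - 1) / 2)) * exp ((1 / 2 - v) * of_real (ln (real p))) * Gamma v"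
    using Gamma_multiplication[of p "v / of_nat p"] assms(1) Re_v by simp
  also have "(\<Prod>i<q. Gamma ((of_real \<mu> / of_nat q + v / of_nat p) + of_nat i / of_nat q)) =
       of_real ((2 * pi) powr ((real q - 1) / 2)) *
       exp ((1 / 2 - (of_real \<mu> + of_real (real q / real p) * v)) * of_real (ln (real q))) *
       Gamma (of_real \<mu> + of_real (real q / real p) * v)"
  proof -
    have "of_nat q * (of_real \<mu> / of_nat q + v / of_nat p) = of_real \<mu> + of_real (real q / real p) * v"
      using assms by (simp add: ring_distribs)
    moreover have "Re (of_real \<mu> / of_nat q + v / of_nat p) > 0"
      using assms Re_v by (simp add: add_pos_pos)
    ultimately show ?thesis
      using Gamma_multiplication[of q "of_real \<mu> / of_nat q + v / of_nat p"] assms(2)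
      by (simp only:)
  qed
  finally have B: "(\<Prod>j<q+p+1. Gamma (of_real (?bs ! j) - s)) =
     of_real ((2 * pi) powr ((real p - 1) / 2)) * exp ((1 / 2 - v) * of_real (ln (real p))) * Gamma v *
     (of_real ((2 * pi) powr ((real q - 1) / 2)) *
       exp ((1 / 2 - (of_real \<mu> + of_real (real q / real p) * v)) * of_real (ln (real q))) *
       Gamma (of_real \<mu> + of_real (real q / real p) * v)) * Gamma (v / of_nat p)" .
  have "(\<Prod>j<p. Gamma (1 - of_real (?as ! j) + s)) = (\<Prod>j<p. Gamma (1 - of_nat j / of_nat p - v / of_nat p))"
    by (intro prod.cong) (auto simp: nth_append s)
  \<comment> \<open>The order is reversed: for \<open>j = p - 1 - i\<close>,
    \<open>1 - j / p\<close> is \<open>(1 + i) / p\<close>.\<close>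
  also have "\<dots> = (\<Prod>i<p. Gamma ((1 - v) / of_nat p + of_nat i / of_nat p))"
    by (rule prod.reindex_bij_witness[of _ "\<lambda>i. p - 1 - i" "\<lambda>i. p - 1 - i"])
       (use np in \<open>auto simp: of_nat_diff field_simps\<close>)
  also have "\<dots> = of_real ((2 * pi) powr ((real p - 1) / 2)) * exp ((v - 1 / 2) * of_real (ln (real p))) * Gamma (1 - v)"
    using Gamma_multiplication[of p "(1 - v) / of_nat p"] assms(1) Re_v by simp
  finally have A: "(\<Prod>j<p. Gamma (1 - of_real (?as ! j) + s)) =
    of_real ((2 * pi) powr ((real p - 1) / 2)) * exp ((v - 1 / 2) * of_real (ln (real p))) * Gamma (1 - v)" .
  have vp: "v / of_nat p \<notin> \<int>\<^sub>\<le>\<^sub>0"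
    using assms Re_v by (intro complex_pos_notin_nonpos_Ints) simp
  hence D: "Gamma (1 - s) = v / of_nat p * Gamma (v / of_nat p)"
    using Gamma_plus1[of "v / of_nat p"] by (simp add: s add.commute)
  have Gnz: "Gamma (v / of_nat p) \<noteq> 0" using vp by (simp add: Gamma_eq_zero_iff)
  have refl: "Gamma v * Gamma (1 - v) = 2 * of_real pi * v * softplus_kernel (- real p * t)"
    using Gamma_reflection_complex[of v] sin_pi_times_half_line[of "- real p * t"] v0
    by (simp add: softplus_kernel_def v_def u_def)
  have E: "exp ((1 / 2 - (of_real \<mu> + of_real (real q / real p) * v)) * of_real (ln (real q))) * exp (s * of_real (ln z))
      = of_real (real q powr (1/2 - \<mu>)) * exp (v * of_real y)"
  proof -
    have "(1 / 2 - (of_real \<mu> + of_real (real q / real p) * v)) * of_real (ln (real q)) + s * of_real (ln z) =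
       of_real ((1/2 - \<mu>) * ln (real q)) + v * of_real y"
      unfolding z s using np by (simp add: field_simps)
    thus ?thesis
      unfolding exp_add[symmetric] using assms(2) by (simp add: exp_add powr_def flip: exp_of_real)
  qed
  have P: "exp ((1 / 2 - v) * of_real (ln (real p))) * exp ((v - 1 / 2) * of_real (ln (real p))) = 1"
    by (simp add: algebra_simps flip: exp_add)
  have C: "(2 * pi) powr ((real p - 1) / 2) * (2 * pi) powr ((real p - 1) / 2) * (2 * pi) powr ((real q - 1) / 2) =
      (2 * pi) powr ((real q - 3) / 2 + real p)"
    unfolding powr_add[symmetric] by (rule arg_cong[of _ _ "(powr) _"]) (simp add: field_simps)
  have "meijerG_integrand (q + p + 1) p ?as ?bs z s =
     (\<Prod>j<q+p+1. Gamma (of_real (?bs ! j) - s)) * (\<Prod>j<p. Gamma (1 - of_real (?as ! j) + s)) / Gamma (1 - s) *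
     exp (s * of_real (ln z))"
  proof -
    have "{q + p + 1..<length ?bs} = {}" "{p..<length ?as} = {p}" by auto
    moreover have "?as ! p = 1" by (simp add: nth_append)
    ultimately show ?thesis unfolding meijerG_integrand_def by (simp only: prod.empty prod.insert finite.emptyI) simp
  qed
  also have "\<dots> = 
     of_real ((2 * pi) powr ((real p - 1) / 2) * (2 * pi) powr ((real p - 1) / 2) * (2 * pi) powr ((real q - 1) / 2)) *
     (exp ((1 / 2 - v) * of_real (ln (real p))) * exp ((v - 1 / 2) * of_real (ln (real p)))) *
     (exp ((1 / 2 - (of_real \<mu> + of_real (real q / real p) * v)) * of_real (ln (real q))) * exp (s * of_real (ln z))) *
     (Gamma v * Gamma (1 - v)) * Gamma (of_real \<mu> + of_real (real q / real p) * v) * (of_nat p / v)"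
    unfolding A B D using Gnz v0 np by (simp only: of_real_mult) (simp add: divide_simps)
  also have "\<dots> = of_real (2 * pi * real p * (2 * pi) powr ((real q - 3) / 2 + real p) * real q powr (1/2 - \<mu>)) *
         (Gamma (of_real \<mu> + of_real (real q / real p) * v) * softplus_kernel (- real p * t) * exp (v * of_real y))"
    unfolding P C E refl using v0 by simp
  finally show ?thesis by (simp only: s_def v_def)
qed

text \<open>The substitution \<open>\<tau> = - p * t\<close> contributes \<open>1 / p\<close>;
  together with the \<open>1 / (2 pi)\<close> in the definition of the G-function it absorbs the
  factor \<open>2 pi p\<close> of the integrand.\<close>

lemma meijerG_capacity:
  assumes "p > 0" "q > 0" "\<mu> > 0" and z: "ln z = - real q * ln (real q) - real p * y"
  shows "meijerG (q + p + 1) p (Delta p 0 @ [1]) (Delta p 0 @ Delta q \<mu> @ [0]) z =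
    of_real ((2 * pi) powr ((real q - 3) / 2 + real p) * real q powr (1/2 - \<mu>) *
      (\<integral>x. exp (\<mu> * x - exp x) * ln (1 + exp (y + real q / real p * x)) \<partial>lborel))"
proof -
  let ?K = "2 * pi * real p * (2 * pi) powr ((real q - 3) / 2 + real p) * real q powr (1/2 - \<mu>)"
  let ?F = "\<lambda>\<tau>. Gamma (of_real \<mu> + of_real (real q / real p) * Complex (1/2) \<tau>) * softplus_kernel \<tau> *
           exp (Complex (1/2) \<tau> * of_real y)"
  have "meijerG (q + p + 1) p (Delta p 0 @ [1]) (Delta p 0 @ Delta q \<mu> @ [0]) z =
     (\<integral>t. of_real ?K * ?F (- real p * t) \<partial>lborel) / (2 * of_real pi)"
    unfolding meijerG_def meijerG_abscissa_capacity[OF assms(1,3)] Let_def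
      meijerG_integrand_capacity[OF assms] ..
  also have "(\<integral>t. of_real ?K * ?F (- real p * t) \<partial>lborel) = of_real ?K * (\<integral>t. ?F (0 + (- real p) * t) \<partial>lborel)"
    by (simp only: integral_mult_right_zero add_0)
  also have "(\<integral>t. ?F (0 + (- real p) * t) \<partial>lborel) = (\<integral>\<tau>. ?F \<tau> \<partial>lborel) / of_nat p"
    using lborel_integral_real_affine[of "- real p" ?F 0] assms(1)
    by (simp add: scaleR_conv_of_real)
  also have "(\<integral>\<tau>. ?F \<tau> \<partial>lborel) = of_real (\<integral>x. exp (\<mu> * x - exp x) * ln (1 + exp (y + real q / real p * x)) \<partial>lborel)"
    using assms by (intro integral_Gamma_softplus) auto
  finally show ?thesis using assms(1) by simp
qed

section \<open>Positivity of the hypergeometric normalisation\<close>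

lemma pochhammer_ge_0_real: "a > 0 \<Longrightarrow> pochhammer a n \<ge> (0::real)"
  by (intro less_imp_le pochhammer_pos)

lemma Gamma_add_nat: "Gamma (a + real n) = Gamma a * pochhammer a n" if "a > 0" for a :: real
proof -
  have "a \<notin> \<int>\<^sub>\<le>\<^sub>0" using that by (auto elim!: nonpos_Ints_cases)
  from pochhammer_Gamma[OF this, of n] Gamma_real_pos[OF that] show ?thesis by simp
qed

section \<open>Convergence of the hypergeometric series\<close>

text \<open>With \<open>K = \<bar>a\<bar> / c + 1\<close> each factor satisfies
  \<open>\<bar>a + n\<bar> \<le> K (c + n)\<close>, so the series is dominated by that of
  \<open>exp (K * \<bar>z\<bar>)\<close>.\<close>

lemma summable_hyp1F1:
  fixes a c z :: real
  assumes "c > 0"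
  shows "summable (\<lambda>n. norm (pochhammer a n / pochhammer c n * z ^ n / fact n))"
proof -
  define K where "K = \<bar>a\<bar> / c + 1"
  have le: "\<bar>pochhammer a n\<bar> \<le> K ^ n * pochhammer c n" for n
  proof (induction n)
    case (Suc n)
    have "\<bar>a + real n\<bar> \<le> \<bar>a\<bar> + real n" by linarith
    also have "\<dots> \<le> K * (c + real n)"
      using assms by (simp add: K_def field_simps)
    finally have "\<bar>pochhammer a n\<bar> * \<bar>a + real n\<bar> \<le> (K ^ n * pochhammer c n) * (K * (c + real n))"
      using Suc by (intro mult_mono) (auto intro!: mult_nonneg_nonneg pochhammer_ge_0_real simp: K_def assms less_imp_le)
    thus ?case by (simp add: pochhammer_Suc abs_mult mult_ac)
  qed auto
  show ?thesis
  proof (rule summable_comparison_test')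
    show "summable (\<lambda>n. (K * \<bar>z\<bar>) ^ n / fact n)"
      using summable_exp[of "K * \<bar>z\<bar>"] by (simp add: field_simps)
    fix n
    have pos: "pochhammer c n > 0" using assms by (rule pochhammer_pos)
    have "\<bar>pochhammer a n\<bar> / pochhammer c n \<le> K ^ n"
      using le[of n] pos by (simp add: field_simps)
    hence "\<bar>pochhammer a n\<bar> / pochhammer c n * (\<bar>z\<bar> ^ n / fact n) \<le> K ^ n * (\<bar>z\<bar> ^ n / fact n)"
      by (intro mult_right_mono) auto
    thus "norm (norm (pochhammer a n / pochhammer c n * z ^ n / fact n)) \<le> (K * \<bar>z\<bar>) ^ n / fact n"
      using pos by (simp add: abs_mult power_abs power_mult_distrib)
  qed
qed

text \<open>Ratio test: consecutive terms differ by a factor whose absolute value tends to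
  \<open>\<bar>z\<bar>\<close> and is eventually below an intermediate \<open>w < 1\<close>.\<close>

lemma summable_hyp2F1:
  fixes a b c z :: real
  assumes "c > 0" "\<bar>z\<bar> < 1"
  shows "summable (\<lambda>n. norm (pochhammer a n * pochhammer b n / pochhammer c n * z ^ n / fact n))"
proof -
  obtain w where w: "\<bar>z\<bar> < w" "w < 1" using assms(2) dense by blast
  have "((\<lambda>n. \<bar>(a + real n) * (b + real n) / ((c + real n) * (1 + real n))\<bar>) \<longlongrightarrow> \<bar>1\<bar>) at_top"
    by (intro tendsto_rabs) real_asymp
  hence "((\<lambda>n. \<bar>(a + real n) * (b + real n) / ((c + real n) * (1 + real n))\<bar> * \<bar>z\<bar>) \<longlongrightarrow> 1 * \<bar>z\<bar>) at_top"
    by (intro tendsto_mult) auto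
  hence "eventually (\<lambda>n. \<bar>(a + real n) * (b + real n) / ((c + real n) * (1 + real n))\<bar> * \<bar>z\<bar> < w) at_top"
    by (rule order_tendstoD) (use w in auto)
  then obtain N where N: "\<And>n. n \<ge> N \<Longrightarrow> \<bar>(a + real n) * (b + real n) / ((c + real n) * (1 + real n))\<bar> * \<bar>z\<bar> < w"
    by (auto simp: eventually_at_top_linorder)
  let ?f = "\<lambda>n. pochhammer a n * pochhammer b n / pochhammer c n * z ^ n / fact n"
  show ?thesis
  proof (rule summable_ratio_test[of w N])
    fix n assume n: "N \<le> n"
    have "?f (Suc n) = ?f n * ((a + real n) * (b + real n) / ((c + real n) * (1 + real n)) * z)"
      by (simp add: pochhammer_Suc mult_ac)
    hence "norm (?f (Suc n)) = norm (?f n) * (\<bar>(a + real n) * (b + real n) / ((c + real n) * (1 + real n))\<bar> * \<bar>z\<bar>)"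
      by (simp only: abs_mult real_norm_def)
    also have "\<dots> \<le> norm (?f n) * w"
      using N[OF n] by (intro mult_left_mono) auto
    finally show "norm (norm (?f (Suc n))) \<le> w * norm (norm (?f n))" by (simp only: real_norm_def abs_idempotent mult.commute[of w])
  qed (use w in auto)
qed

section \<open>Kummer's transformation and positivity\<close>

text \<open>In the Cauchy product of the two series on the right, each coefficient is a
  Chu-Vandermonde sum. For \<open>b < c\<close> and \<open>y \<ge> 0\<close> the \<open>1F1\<close>
  series on the right has nonnegative terms, which makes positivity visible.\<close>

lemma hyp1F1_Kummer:
  assumes "c > 0"
  shows "hyp1F1 b c (- y) = hyp1F1 (c - b) c y * exp (- y)"
proof -
  let ?f = "\<lambda>n. pochhammer (c - b) n / pochhammer c n * y ^ n / fact n" and ?g = "\<lambda>n. (- y) ^ n / fact n"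
  have "(\<lambda>n. \<Sum>i\<le>n. ?f i * ?g (n - i)) sums ((\<Sum>n. ?f n) * (\<Sum>n. ?g n))"
  proof (rule Cauchy_product_sums)
    show "summable (\<lambda>n. norm (?f n))" by (rule summable_hyp1F1[OF assms])
    show "summable (\<lambda>n. norm (?g n))"
      using summable_norm_exp[of "- y"] by (simp add: field_simps)
  qed
  moreover have "(\<Sum>n. ?g n) = exp (- y)"
    by (simp add: exp_def scaleR_conv_of_real field_simps)
  moreover have "(\<Sum>i\<le>n. ?f i * ?g (n - i)) = pochhammer b n / pochhammer c n * (- y) ^ n / fact n" for n
  proof -
    \<comment> \<open>The factorial of \<open>n - i\<close> is expressed through
      \<open>pochhammer (- n) i\<close>, the form to which Vandermonde's sum applies.\<close>
    have "?f i * ?g (n - i) = (- y) ^ n / fact n *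
        (pochhammer (c - b) i * pochhammer (- of_nat n) i / (of_nat (fact i) * pochhammer c i))" if "i \<le> n" for i
    proof -
      have "pochhammer (- real n) i = (-1) ^ i * (fact n / fact (n - i))"
      proof -
        have "real (n choose i) = (-1) ^ i * pochhammer (- real n) i / fact i"
          by (simp add: binomial_gbinomial gbinomial_pochhammer)
        moreover have "real (n choose i) = fact n / (fact i * fact (n - i))"
          using that by (rule binomial_fact)
        ultimately show ?thesis
          by (simp add: field_simps)
      qed
      moreover have "(- y) ^ n = (- y) ^ i * (- y) ^ (n - i)" using that by (simp flip: power_add)
      moreover have "y ^ i = (-1) ^ i * (- y) ^ i" by (simp flip: power_mult_distrib)
      ultimately show ?thesis by (simp add: mult_ac)
    qed
    hence "(\<Sum>i\<le>n. ?f i * ?g (n - i)) = (- y) ^ n / fact n * (\<Sum>i=0..n.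
        pochhammer (c - b) i * pochhammer (- of_nat n) i / (of_nat (fact i) * pochhammer c i))"
      unfolding sum_distrib_left by (intro sum.cong) (auto simp: atMost_atLeast0)
    also have "(\<Sum>i=0..n. pochhammer (c - b) i * pochhammer (- of_nat n) i / (of_nat (fact i) * pochhammer c i))
        = pochhammer (c - (c - b)) n / pochhammer c n"
      using assms by (intro Vandermonde_pochhammer) (auto simp: add_eq_0_iff)
    finally show ?thesis by (simp add: mult_ac)
  qed
  ultimately have "(\<lambda>n. pochhammer b n / pochhammer c n * (- y) ^ n / fact n) sums (hyp1F1 (c - b) c y * exp (- y))"
    by (simp only: hyp1F1_def)
  thus ?thesis by (simp add: hyp1F1_def sums_iff)
qed

lemma hyp1F1_pos:
  assumes "a > 0" "c > 0" "y \<ge> 0"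
  shows "hyp1F1 a c y > 0"
  unfolding hyp1F1_def
proof (rule suminf_pos2[where i = 0])
  show "summable (\<lambda>n. pochhammer a n / pochhammer c n * y ^ n / fact n)"
    using summable_hyp1F1[OF assms(2)] by (rule summable_norm_cancel)
qed (use assms in \<open>auto intro!: mult_nonneg_nonneg divide_nonneg_nonneg pochhammer_ge_0_real\<close>)

lemma hyp2F1_series_pos:
  assumes "a > 0" "b > 0" "c > 0" "0 \<le> z" "z < 1"
  shows "hyp2F1_series a b c z > 0"
  unfolding hyp2F1_series_def
proof (rule suminf_pos2[where i = 0])
  show "summable (\<lambda>n. pochhammer a n * pochhammer b n / pochhammer c n * z ^ n / fact n)"
    by (rule summable_norm_cancel[OF summable_hyp2F1]) (use assms in auto)
qed (use assms in \<open>auto intro!: mult_nonneg_nonneg divide_nonneg_nonneg pochhammer_ge_0_real\<close>)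

text \<open>Averaging \<open>1F1 (b; c; z Y)\<close> over a Gamma-distributed \<open>Y\<close> of shape \<open>a\<close> gives
  \<open>2F1 (a, b; c; z)\<close>, and Kummer's transformation makes the integrand positive.\<close>

lemma hyp2F1_series_neg_arg_pos:
  assumes "a > 0" "c > 0" "b < c" "0 \<le> w" "w < 1"
  shows "hyp2F1_series a b c (- w) > 0"
proof -
  let ?t = "\<lambda>n. pochhammer b n / pochhammer c n * (- w) ^ n / fact n"
  let ?f = "\<lambda>n x. ?t n * exp ((a + real n) * x - exp x)"
  have int: "has_bochner_integral lborel (?f n) (?t n * Gamma (a + real n))" for n
    using assms by (intro has_bochner_integral_mult_right has_bochner_integral_Gamma_real) auto
  have int_norm: "has_bochner_integral lborel (\<lambda>x. norm (?f n x)) (norm (?t n) * Gamma (a + real n))" for n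
  proof -
    have "norm (?f n x) = norm (?t n) * exp ((a + real n) * x - exp x)" for x
      by (simp only: real_norm_def abs_mult[of "?t n"] abs_exp_cancel)
    thus ?thesis
      unfolding \<open>\<And>x. norm (?f n x) = _\<close>
      using assms by (intro has_bochner_integral_mult_right has_bochner_integral_Gamma_real) auto
  qed
  note Gam = Gamma_add_nat[OF assms(1)]
  have split: "exp ((a + real n) * x - exp x) = exp (a * x - exp x) * exp x ^ n" for n x
    by (simp add: algebra_simps flip: exp_of_nat_mult exp_add)
  have f_eq: "?f n x = exp (a * x - exp x) * (pochhammer b n / pochhammer c n * (- (w * exp x)) ^ n / fact n)" for n x
  proof -
    have "(- (w * exp x)) ^ n = (- w) ^ n * exp x ^ n" by (simp flip: power_mult_distrib)
    thus ?thesis unfolding split by simp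
  qed
  have sums_f: "(\<Sum>n. ?f n x) = exp (a * x - exp x) * hyp1F1 b c (- (w * exp x))" for x
    unfolding f_eq hyp1F1_def
    by (intro suminf_mult summable_norm_cancel[OF summable_hyp1F1] assms)
  have summ: "summable (\<lambda>n. norm (?f n x))" for x
    unfolding f_eq norm_mult[of "exp _"]
    by (intro summable_mult summable_hyp1F1 assms)
  \<comment> \<open>The norm integrals are \<open>Gamma a\<close> times the absolute terms of the
    \<open>2F1\<close> series, so \<open>w < 1\<close> licenses the exchange of sum and
    integral.\<close>
  have summ_int: "summable (\<lambda>n. \<integral>x. norm (?f n x) \<partial>lborel)"
  proof -
    have "norm (?t n) * Gamma (a + real n) = Gamma a * norm (pochhammer a n * pochhammer b n / pochhammer c n * (- w) ^ n / fact n)" for n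
      using pochhammer_ge_0_real[OF assms(1), of n] by (simp add: Gam abs_mult)
    moreover have "summable (\<lambda>n. Gamma a *
        norm (pochhammer a n * pochhammer b n / pochhammer c n * (- w) ^ n / fact n))"
      using assms by (intro summable_mult summable_hyp2F1) auto
    ultimately show ?thesis
      unfolding has_bochner_integral_integral_eq[OF int_norm] by (simp only:)
  qed
  have intf: "integrable lborel (?f n)" for n using int by (simp only: has_bochner_integral_iff)
  have S: "(\<lambda>n. integral\<^sup>L lborel (?f n)) sums (\<integral>x. (\<Sum>n. ?f n x) \<partial>lborel)"
    by (intro sums_integral intf AE_I2 summ summ_int)
  have I: "integrable lborel (\<lambda>x. (\<Sum>n. ?f n x))"
    by (intro integrable_suminf intf AE_I2 summ summ_int)
  have "?t n * Gamma (a + real n) = Gamma a * (pochhammer a n * pochhammer b n / pochhammer c n * (- w) ^ n / fact n)" for n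
    by (simp add: Gam)
  with S have "(\<integral>x. (\<Sum>n. ?f n x) \<partial>lborel) = (\<Sum>n. Gamma a * (pochhammer a n * pochhammer b n / pochhammer c n * (- w) ^ n / fact n))"
    unfolding has_bochner_integral_integral_eq[OF int] by (simp only: sums_iff)
  also have "\<dots> = Gamma a * hyp2F1_series a b c (- w)"
    unfolding hyp2F1_series_def using assms
    by (intro suminf_mult summable_norm_cancel[OF summable_hyp2F1]) auto
  finally have eq: "(\<integral>x. (\<Sum>n. ?f n x) \<partial>lborel) = Gamma a * hyp2F1_series a b c (- w)" .
  \<comment> \<open>\<open>b\<close> may be negative, but Kummer's transformation replaces it by
    \<open>c - b > 0\<close> and makes the argument nonnegative.\<close>
  have pos: "(\<Sum>n. ?f n x) > 0" for x
    unfolding sums_f hyp1F1_Kummer[OF assms(2)]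
    using assms by (intro mult_pos_pos hyp1F1_pos) auto
  have "(\<integral>x. (\<Sum>n. ?f n x) \<partial>lborel) \<ge> 0"
    using pos by (intro integral_nonneg_AE) (auto intro: less_imp_le)
  moreover have "(\<integral>x. (\<Sum>n. ?f n x) \<partial>lborel) \<noteq> 0"
  proof
    assume "(\<integral>x. (\<Sum>n. ?f n x) \<partial>lborel) = 0"
    hence "AE x in lborel. (\<Sum>n. ?f n x) = 0"
      using pos by (subst (asm) integral_nonneg_eq_0_iff_AE[OF I]) (auto intro: less_imp_le)
    hence "AE x in (lborel :: real measure). False"
      using pos by (auto elim!: eventually_mono simp: less_le)
    thus False by (simp add: AE_iff_null null_sets_def)
  qed
  ultimately have "Gamma a * hyp2F1_series a b c (- w) > 0" unfolding eq by linarith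
  thus ?thesis using Gamma_real_pos[OF assms(1)] by (simp add: zero_less_mult_iff)
qed

text \<open>Inside the unit disc the Gamma average applies. For \<open>z \<le> - 1\<close> the Pfaff
  branch has positive parameters \<open>a\<close>, \<open>c - b\<close>, \<open>c\<close> and
  argument \<open>z / (z - 1)\<close> in \<open>[0, 1)\<close>, so its series is positive term by
  term.\<close>

lemma hyp2F1_nonpos_arg_pos:
  assumes "a > 0" "c > 0" "b < c" "z \<le> 0"
  shows "hyp2F1 a b c z > 0"
proof (cases "\<bar>z\<bar> < 1")
  case True
  thus ?thesis
    using hyp2F1_series_neg_arg_pos[of a c b "- z"] assms by (simp add: hyp2F1_def)
next
  case False
  have "0 \<le> z / (z - 1)" "z / (z - 1) < 1"
    using assms by (auto simp: divide_simps)
  thus ?thesis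
    using False assms by (auto simp: hyp2F1_def intro!: mult_pos_pos hyp2F1_series_pos)
qed

text \<open>The second parameter \<open>- 2 / \<alpha>\<close> is negative, hence below
  \<open>mX\<close>, and the argument is negative too. Positivity lets the logarithm of the SNR
  split into a sum.\<close>

lemma bx_C_pos:
  assumes "mX > 0" "mY > 0" "OX > 0" "OY > 0" "\<alpha> > 0"
  shows "bx_C \<alpha> mX mY OX OY > 0"
proof -
  have "hyp2F1 mY (- 2 / \<alpha>) mX (- mX * OY / (mY * OX)) > 0"
    using assms by (intro hyp2F1_nonpos_arg_pos) (auto simp: divide_simps add_pos_pos intro: order.strict_trans[of _ 0])
  moreover have "Gamma mX > 0" "Gamma (mX + 2 / \<alpha>) > 0"
    using assms by (auto intro!: Gamma_real_pos add_pos_pos)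
  ultimately have "Gamma mX / (Gamma (mX + 2 / \<alpha>) * hyp2F1 mY (- 2 / \<alpha>) mX (- mX * OY / (mY * OX))) > 0"
    by (intro divide_pos_pos mult_pos_pos)
  thus ?thesis
    unfolding bx_C_def powr_gt_zero by linarith
qed

section \<open>The ergodic capacity\<close>

text \<open>Substitution \<open>x = ln (mX r^2 / OX)\<close>, carried out as
  \<open>r = exp (c + x / 2)\<close>, an affine map followed by the exponential.\<close>

lemma bx_expectation:
  fixes g :: "real \<Rightarrow> real"
  assumes dist: "distributed M lborel R (\<lambda>r. ennreal (bx_pdf mX mY OX OY r))"
    and pos: "mX > 0" "mY > 0" "OX > 0" "OY > 0"
    and g [measurable]: "g \<in> borel_measurable borel"
  defines "\<beta> \<equiv> bx_beta mX mY OX OY"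
  assumes I: "has_bochner_integral lborel (\<lambda>x. (1 - \<beta>) powr mY / Gamma mX * exp (mX * x - exp x) *
        hyp1F1 mY mX (\<beta> * exp x) * g (sqrt (OX / mX) * exp (x / 2))) I"
  shows "(\<integral>\<omega>. g (R \<omega>) \<partial>M) = I"
proof -
  let ?pdf = "bx_pdf mX mY OX OY"
  have nonneg: "?pdf r \<ge> 0" for r
    using pos by (auto simp: bx_pdf_def intro!: mult_nonneg_nonneg divide_nonneg_nonneg less_imp_le[OF hyp1F1_pos]
        less_imp_le[OF Gamma_real_pos] add_nonneg_nonneg)
  have [measurable]: "?pdf \<in> borel_measurable borel"
  proof -
    \<comment> \<open>Measurability of the density is inherited from \<open>distributed\<close>; by
      nonnegativity \<open>enn2real\<close> undoes \<open>ennreal\<close>.\<close>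
    have "(\<lambda>r. ennreal (?pdf r)) \<in> borel_measurable lborel"
      using dist by (simp add: distributed_def)
    hence "(\<lambda>r. enn2real (ennreal (?pdf r))) \<in> borel_measurable lborel" by measurable
    thus ?thesis using nonneg by simp
  qed
  define c where "c = ln (sqrt (OX / mX))"
  have ec: "exp c = sqrt (OX / mX)" using pos by (simp add: c_def)
  \<comment> \<open>The factors \<open>1/2\<close> and \<open>exp (c + 1/2 * x)\<close> are the
    Jacobians of the affine map and of the exponential.\<close>
  have pt: "1/2 * (exp (c + 1/2 * x) * (?pdf (exp (c + 1/2 * x)) * g (exp (c + 1/2 * x)))) =
      (1 - \<beta>) powr mY / Gamma mX * exp (mX * x - exp x) *
        hyp1F1 mY mX (\<beta> * exp x) * g (sqrt (OX / mX) * exp (x / 2))" for x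
  proof -
    define r where "r = exp (c + 1/2 * x)"
    have r: "r = sqrt (OX / mX) * exp (x / 2)" by (simp add: r_def exp_add ec)
    have r0: "r > 0" by (simp add: r_def)
    have r2: "r\<^sup>2 = OX / mX * exp x"
      using pos by (simp add: r power_mult_distrib flip: exp_of_nat_mult)
    define D where "D = mY * OX + mX * OY"
    have "D > 0" unfolding D_def using pos by (intro add_pos_pos) auto
    hence z: "mX\<^sup>2 * OY * r\<^sup>2 / (OX * D) = \<beta> * exp x" and e: "- (mX / OX) * r\<^sup>2 = - exp x"
      unfolding r2 \<beta>_def bx_beta_def D_def[symmetric] using pos
      by (simp_all add: field_simps power2_eq_square)
    have b: "mY * OX / D = 1 - \<beta>"
    proof -
      have "mY * OX = D - mX * OY" by (simp add: D_def)
      thus ?thesis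
        using \<open>D > 0\<close> by (simp add: \<beta>_def bx_beta_def D_def[symmetric] diff_divide_distrib)
    qed
    have "r powr (2 * mX - 1) * r * (mX / OX) powr mX = exp (mX * x)"
    proof -
      have "r powr (2 * mX - 1) * r = r powr (2 * mX)"
        using r0 by (simp add: powr_diff)
      also have "\<dots> = (r\<^sup>2) powr mX"
        using r0 by (simp add: powr_powr flip: powr_numeral)
      also have "\<dots> * (mX / OX) powr mX = (r\<^sup>2 * (mX / OX)) powr mX"
        by (rule powr_mult[symmetric])
      also have "r\<^sup>2 * (mX / OX) = exp x" using pos by (simp add: r2)
      finally show ?thesis by (simp add: powr_def)
    qed
    hence "1/2 * (r * ?pdf r) = (1 - \<beta>) powr mY / Gamma mX * exp (mX * x - exp x) * hyp1F1 mY mX (\<beta> * exp x)"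
      unfolding bx_pdf_def D_def[symmetric] b z e using r0 by (simp add: exp_diff exp_minus field_simps)
    thus ?thesis
      unfolding r_def[symmetric] r[symmetric] by (simp only: mult.assoc[symmetric])
  qed
  have "has_bochner_integral lborel (\<lambda>x. exp x *\<^sub>R (?pdf (exp x) * g (exp x))) I"
  proof (subst lborel_has_bochner_integral_real_affine_iff[of "1/2" _ _ c])
    show "has_bochner_integral lborel
       (\<lambda>x. exp (c + 1/2 * x) *\<^sub>R (?pdf (exp (c + 1/2 * x)) * g (exp (c + 1/2 * x)))) (I /\<^sub>R \<bar>1/2\<bar>)"
      using has_bochner_integral_mult_right[OF I[folded pt], of 2] by simp
  qed auto
  hence "has_bochner_integral lborel (\<lambda>r. indicator {0<..} r *\<^sub>R (?pdf r * g r)) I"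
    by (subst (asm) has_bochner_integral_exp_substitution) measurable
  moreover have "indicator {0<..} r *\<^sub>R (?pdf r * g r) = ?pdf r * g r" for r
    by (auto simp: indicator_def bx_pdf_def)
  ultimately have "(\<integral>r. ?pdf r * g r \<partial>lborel) = I"
    by (simp only: has_bochner_integral_iff)
  also have "(\<integral>r. ?pdf r * g r \<partial>lborel) = (\<integral>\<omega>. g (R \<omega>) \<partial>M)"
    using dist nonneg by (intro distributed_integral) auto
  finally show ?thesis .
qed

text \<open>The inequality \<open>ln (1 + t) \<le> t\<close> gives a Gamma integrand at
  \<open>\<mu> + \<rho>\<close> as majorant; the resulting bound controls the growth in
  \<open>k\<close> when the terms are summed.\<close>

lemma integrable_Gamma_softplus:
  fixes \<mu> \<rho> y :: real
  assumes "\<mu> > 0" "\<rho> > 0"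
  shows "integrable lborel (\<lambda>x. exp (\<mu> * x - exp x) * ln (1 + exp (y + \<rho> * x)))"
    and "(\<integral>x. exp (\<mu> * x - exp x) * ln (1 + exp (y + \<rho> * x)) \<partial>lborel) \<le> exp y * Gamma (\<mu> + \<rho>)"
proof -
  have le: "exp (\<mu> * x - exp x) * ln (1 + exp (y + \<rho> * x)) \<le> exp y * exp ((\<mu> + \<rho>) * x - exp x)" for x
  proof -
    have "ln (1 + exp (y + \<rho> * x)) \<le> exp (y + \<rho> * x)"
      by (rule ln_add_one_self_le_self) simp
    hence "exp (\<mu> * x - exp x) * ln (1 + exp (y + \<rho> * x)) \<le> exp (\<mu> * x - exp x) * exp (y + \<rho> * x)"
      by (intro mult_left_mono) auto
    also have "\<dots> = exp y * exp ((\<mu> + \<rho>) * x - exp x)"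
      unfolding exp_add[symmetric] by (rule arg_cong[of _ _ exp]) (simp add: algebra_simps)
    finally show ?thesis .
  qed
  have ge: "exp (\<mu> * x - exp x) * ln (1 + exp (y + \<rho> * x)) \<ge> 0" for x
    by (intro mult_nonneg_nonneg) auto
  have G: "has_bochner_integral lborel (\<lambda>x. exp y * exp ((\<mu> + \<rho>) * x - exp x)) (exp y * Gamma (\<mu> + \<rho>))"
    using assms by (intro has_bochner_integral_mult_right has_bochner_integral_Gamma_real) auto
  show int: "integrable lborel (\<lambda>x. exp (\<mu> * x - exp x) * ln (1 + exp (y + \<rho> * x)))"
    by (rule Bochner_Integration.integrable_bound[of _ "\<lambda>x. exp y * exp ((\<mu> + \<rho>) * x - exp x)"])
       (use G le ge in \<open>auto simp: has_bochner_integral_iff\<close>)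
  show "(\<integral>x. exp (\<mu> * x - exp x) * ln (1 + exp (y + \<rho> * x)) \<partial>lborel) \<le> exp y * Gamma (\<mu> + \<rho>)"
    using integral_mono[OF int _ le] G by (simp add: has_bochner_integral_iff)
qed

text \<open>In the logarithmic variable the SNR is \<open>exp (y + 2 / \<alpha> * x)\<close> and
  \<open>1F1\<close> is integrated term by term. The exchange is licensed by the series of
  \<open>2F1 (mY, mX + 2 / \<alpha>; mX; \<beta>)\<close>, convergent because
  \<open>0 < \<beta> < 1\<close>.\<close>

lemma bx_capacity_sums:
  assumes dist: "distributed M lborel R (\<lambda>r. ennreal (bx_pdf mX mY OX OY r))"
    and pos: "mX > 0" "mY > 0" "OX > 0" "OY > 0" "gbar > 0" "\<alpha> > 0"
  defines "\<beta> \<equiv> bx_beta mX mY OX OY"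
  defines "y \<equiv> ln gbar + 2 / \<alpha> * ln (bx_C \<alpha> mX mY OX OY)"
  shows "(\<lambda>k. (1 - \<beta>) powr mY / ln 2 * (pochhammer mY k / Gamma (mX + real k) * \<beta> ^ k / fact k) *
            (\<integral>x. exp ((mX + real k) * x - exp x) * ln (1 + exp (y + 2 / \<alpha> * x)) \<partial>lborel))
         sums (\<integral>\<omega>. log 2 (1 + alpha_bx_snr \<alpha> mX mY OX OY gbar (R \<omega>)) \<partial>M)"
proof -
  let ?C = "bx_C \<alpha> mX mY OX OY"
  define \<rho> where "\<rho> = 2 / \<alpha>"
  have \<rho>: "\<rho> > 0" using pos by (simp add: \<rho>_def)
  have C: "?C > 0" using pos by (intro bx_C_pos)
  have \<beta>: "0 < \<beta>" "\<beta> < 1"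
    using pos by (auto simp: \<beta>_def bx_beta_def divide_simps add_pos_pos)
  let ?g = "\<lambda>r. log 2 (1 + alpha_bx_snr \<alpha> mX mY OX OY gbar r)"
  have g: "?g (sqrt (OX / mX) * exp (x / 2)) = ln (1 + exp (y + \<rho> * x)) / ln 2" for x
  proof -
    have "?C * mX * (sqrt (OX / mX) * exp (x / 2))\<^sup>2 / OX = ?C * exp x"
      using pos by (simp add: power_mult_distrib flip: exp_of_nat_mult)
    hence "alpha_bx_snr \<alpha> mX mY OX OY gbar (sqrt (OX / mX) * exp (x / 2)) = gbar * (?C * exp x) powr \<rho>"
      unfolding alpha_bx_snr_def \<rho>_def by simp
    also have "\<dots> = exp (y + \<rho> * x)"
      using C pos by (simp add: powr_def ln_mult y_def \<rho>_def[symmetric] exp_add ring_distribs)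
    finally show ?thesis by (simp add: log_def)
  qed
  have meas: "?g \<in> borel_measurable borel"
    unfolding alpha_bx_snr_def by measurable
  let ?A = "\<lambda>k. (1 - \<beta>) powr mY / ln 2 * (pochhammer mY k / Gamma (mX + real k) * \<beta> ^ k / fact k)"
  let ?h = "\<lambda>k x. exp ((mX + real k) * x - exp x) * ln (1 + exp (y + \<rho> * x))"
  let ?f = "\<lambda>k x. ?A k * ?h k x"
  have A0: "?A k \<ge> 0" for k
    using pos \<beta> by (intro mult_nonneg_nonneg divide_nonneg_nonneg less_imp_le[OF Gamma_real_pos] pochhammer_ge_0_real) auto
  have h0: "?h k x \<ge> 0" for k x by (intro mult_nonneg_nonneg) auto
  have int: "integrable lborel (?f k)" for k
    using pos \<rho> by (intro integrable_mult_right integrable_Gamma_softplus) auto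
  have expand: "?f k x = (1 - \<beta>) powr mY / Gamma mX * exp (mX * x - exp x) * (ln (1 + exp (y + \<rho> * x)) / ln 2) *
      (pochhammer mY k / pochhammer mX k * (\<beta> * exp x) ^ k / fact k)" for k x
  proof -
    have "exp ((mX + real k) * x - exp x) = exp (mX * x - exp x) * exp x ^ k"
      by (simp add: algebra_simps flip: exp_of_nat_mult exp_add)
    thus ?thesis by (simp add: Gamma_add_nat[OF pos(1)] power_mult_distrib mult_ac)
  qed
  have summ: "summable (\<lambda>k. norm (?f k x))" for x
    unfolding expand norm_mult[of "_ * (_ / ln 2)"]
    using pos by (intro summable_mult summable_hyp1F1)
  have sum_f: "(\<Sum>k. ?f k x) = (1 - \<beta>) powr mY / Gamma mX * exp (mX * x - exp x) *
        hyp1F1 mY mX (\<beta> * exp x) * ?g (sqrt (OX / mX) * exp (x / 2))" for x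
    unfolding expand g hyp1F1_def using pos
    by (subst suminf_mult[OF summable_norm_cancel[OF summable_hyp1F1]]) (auto simp: mult_ac)
  have summ_int: "summable (\<lambda>k. \<integral>x. norm (?f k x) \<partial>lborel)"
  proof (rule summable_comparison_test')
    \<comment> \<open>\<open>K\<close> collects the factors independent of \<open>k\<close> once
      \<open>Gamma (mX + k)\<close> and \<open>Gamma (mX + \<rho> + k)\<close> are written with
      Pochhammer symbols.\<close>
    define K where "K = (1 - \<beta>) powr mY / ln 2 * exp y * (Gamma (mX + \<rho>) / Gamma mX)"
    show "summable (\<lambda>k. K * norm (pochhammer mY k * pochhammer (mX + \<rho>) k / pochhammer mX k * \<beta> ^ k / fact k))"
      using \<beta> pos by (intro summable_mult summable_hyp2F1) auto
    fix k
    have "norm (\<integral>x. norm (?f k x) \<partial>lborel) = ?A k * (\<integral>x. ?h k x \<partial>lborel)"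
    proof -
      have "norm (?f k x) = ?f k x" for x
        by (simp only: real_norm_def abs_of_nonneg mult_nonneg_nonneg A0 h0)
      moreover have "(\<integral>x. ?h k x \<partial>lborel) \<ge> 0"
        by (intro Bochner_Integration.integral_nonneg h0)
      ultimately show ?thesis
        using A0[of k]
        by (simp only: integral_mult_right_zero real_norm_def abs_of_nonneg mult_nonneg_nonneg)
    qed
    also have "\<dots> \<le> ?A k * (exp y * Gamma (mX + real k + \<rho>))"
      using pos \<rho> by (intro mult_left_mono A0 integrable_Gamma_softplus) auto
    also have "mX + real k + \<rho> = (mX + \<rho>) + real k" by simp
    also have "?A k * (exp y * Gamma ((mX + \<rho>) + real k)) =
        K * (pochhammer mY k * pochhammer (mX + \<rho>) k / pochhammer mX k * \<beta> ^ k / fact k)"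
      using pos \<rho> by (simp add: Gamma_add_nat K_def mult_ac)
    also have "\<dots> \<le> K * norm (pochhammer mY k * pochhammer (mX + \<rho>) k / pochhammer mX k * \<beta> ^ k / fact k)"
    proof (rule mult_left_mono)
      show "K \<ge> 0"
        using pos \<rho> by (auto simp: K_def intro!: mult_nonneg_nonneg divide_nonneg_nonneg less_imp_le[OF Gamma_real_pos])
    qed (simp only: real_norm_def abs_ge_self)
    finally show "norm (\<integral>x. norm (?f k x) \<partial>lborel) \<le> K * norm (pochhammer mY k * pochhammer (mX + \<rho>) k / pochhammer mX k * \<beta> ^ k / fact k)" .
  qed
  define L where "L = (\<integral>x. (\<Sum>k. ?f k x) \<partial>lborel)"
  have S: "(\<lambda>k. integral\<^sup>L lborel (?f k)) sums L"
    unfolding L_def by (intro sums_integral int AE_I2 summ summ_int)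
  have "integrable lborel (\<lambda>x. \<Sum>k. ?f k x)"
    by (intro integrable_suminf int AE_I2 summ summ_int)
  hence "has_bochner_integral lborel (\<lambda>x. \<Sum>k. ?f k x) L"
    by (simp only: has_bochner_integral_iff L_def)
  hence "(\<integral>\<omega>. ?g (R \<omega>) \<partial>M) = L"
    unfolding sum_f unfolding \<beta>_def by (rule bx_expectation[OF dist pos(1-4) meas])
  with S show ?thesis
    unfolding integral_mult_right_zero \<rho>_def by (simp only:)
qed

theorem theorem3:
  fixes M :: "'a measure" and R :: "'a \<Rightarrow> real"
    and mX mY OX OY gbar :: real and p q :: nat
  assumes "prob_space M"
    and "distributed M lborel R (\<lambda>r. ennreal (bx_pdf mX mY OX OY r))"
    and "mX > 0" "mY > 0" "OX > 0" "OY > 0" "gbar > 0"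
    and "p > 0" "q > 0" "coprime p q"
  shows
    "let \<alpha> = 2 * real p / real q;
         \<beta> = bx_beta mX mY OX OY;
         C\<alpha> = bx_C \<alpha> mX mY OX OY;
         Cbar = prob_space.expectation M (\<lambda>\<omega>. log 2 (1 + alpha_bx_snr \<alpha> mX mY OX OY gbar (R \<omega>)))
     in (\<lambda>k. of_real (real q powr (mX - 1/2) * (1 - \<beta>) powr mY
                / ((2 * pi) powr ((real q - 3) / 2 + real p) * ln 2)
                * (pochhammer mY k / Gamma (mX + real k) * (real q * \<beta>) ^ k / fact k))
            * meijerG (q + p + 1) p (Delta p 0 @ [1]) (Delta p 0 @ Delta q (mX + real k) @ [0])
                ((1 / (real q * C\<alpha> * gbar powr (\<alpha> / 2))) ^ q))
        sums (of_real Cbar :: complex)"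
proof -
  define \<alpha> where "\<alpha> = 2 * real p / real q"
  define \<beta> where "\<beta> = bx_beta mX mY OX OY"
  define C where "C = bx_C \<alpha> mX mY OX OY"
  define y where "y = ln gbar + 2 / \<alpha> * ln C"
  define z where "z = (1 / (real q * C * gbar powr (\<alpha> / 2))) ^ q"
  have \<alpha>: "\<alpha> > 0" and \<rho>: "2 / \<alpha> = real q / real p" using assms by (auto simp: \<alpha>_def)
  have C: "C > 0" unfolding C_def using assms \<alpha> by (intro bx_C_pos)
  \<comment> \<open>Because \<open>q * (\<alpha> / 2) = p\<close>, the outer exponent
    \<open>q\<close> produces \<open>p * ln gbar + q * ln C\<close>, which is
    \<open>p * y\<close>.\<close>
  have z: "ln z = - real q * ln (real q) - real p * y"
  proof -
    have "ln z = - real q * (ln (real q) + ln C + \<alpha> / 2 * ln gbar)"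
      unfolding z_def using assms C by (simp add: ln_realpow ln_div ln_mult ln_powr algebra_simps)
    also have "\<dots> = - real q * ln (real q) - real p * y"
      unfolding y_def \<rho> using assms by (simp add: \<alpha>_def field_simps)
    finally show ?thesis .
  qed
  define J where "J = (\<lambda>k. \<integral>x. exp ((mX + real k) * x - exp x) * ln (1 + exp (y + 2 / \<alpha> * x)) \<partial>lborel)"
  have term_eq: "of_real (real q powr (mX - 1/2) * (1 - \<beta>) powr mY
                / ((2 * pi) powr ((real q - 3) / 2 + real p) * ln 2)
                * (pochhammer mY k / Gamma (mX + real k) * (real q * \<beta>) ^ k / fact k))
            * meijerG (q + p + 1) p (Delta p 0 @ [1]) (Delta p 0 @ Delta q (mX + real k) @ [0]) z =
       of_real ((1 - \<beta>) powr mY / ln 2 * (pochhammer mY k / Gamma (mX + real k) * \<beta> ^ k / fact k) * J k)" for k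
  proof -
    define T where "T = (2 * pi) powr ((real q - 3) / 2 + real p)"
    have T: "T > 0" by (simp add: T_def)
    \<comment> \<open>The G-function contributes \<open>q\<close> to the power
      \<open>1/2 - mX - k\<close>; the prefactor and the \<open>q ^ k\<close> inside
      \<open>(q * \<beta>) ^ k\<close> cancel it.\<close>
    have "real q powr (mX - 1/2) * real q ^ k * real q powr (1/2 - (mX + real k)) = 1"
      using assms(9) by (simp add: powr_realpow[symmetric] flip: powr_add)
    hence q: "real q powr (1/2 - (mX + real k)) = 1 / (real q powr (mX - 1/2) * real q ^ k)"
      using assms(9) by (simp add: field_simps)
    have "meijerG (q + p + 1) p (Delta p 0 @ [1]) (Delta p 0 @ Delta q (mX + real k) @ [0]) z =
      of_real (T * real q powr (1/2 - (mX + real k)) * J k)"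
      unfolding J_def T_def \<rho> using assms z by (intro meijerG_capacity) auto
    moreover have "real q powr (mX - 1/2) * (1 - \<beta>) powr mY / (T * ln 2) *
        (pochhammer mY k / Gamma (mX + real k) * (real q * \<beta>) ^ k / fact k) *
        (T * real q powr (1/2 - (mX + real k)) * J k) =
        (1 - \<beta>) powr mY / ln 2 * (pochhammer mY k / Gamma (mX + real k) * \<beta> ^ k / fact k) * J k"
      unfolding q using T assms(9) by (simp add: power_mult_distrib)
    ultimately show ?thesis
      unfolding T_def[symmetric] by (simp only: flip: of_real_mult)
  qed
  have "(\<lambda>k. (1 - \<beta>) powr mY / ln 2 * (pochhammer mY k / Gamma (mX + real k) * \<beta> ^ k / fact k) * J k)
      sums (\<integral>\<omega>. log 2 (1 + alpha_bx_snr \<alpha> mX mY OX OY gbar (R \<omega>)) \<partial>M)"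
    unfolding J_def y_def \<beta>_def C_def using assms \<alpha> by (intro bx_capacity_sums)
  hence "(\<lambda>k. complex_of_real ((1 - \<beta>) powr mY / ln 2 * (pochhammer mY k / Gamma (mX + real k) * \<beta> ^ k / fact k) * J k))
      sums of_real (\<integral>\<omega>. log 2 (1 + alpha_bx_snr \<alpha> mX mY OX OY gbar (R \<omega>)) \<partial>M)"
    by (simp only: sums_of_real_iff)
  thus ?thesis
    unfolding Let_def \<alpha>_def[symmetric] \<beta>_def[symmetric] C_def[symmetric] z_def[symmetric] term_eq .
qed

end
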